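(* Let $\pmb\alpha=(\alpha_1,\alpha_2,\alpha_3)$, $\alpha_i\in\mathbb S^1\setminus\Omega$, be a triple of parameters, let $\pmb\sigma=(\sigma_1,\sigma_2,\sigma_3)$, $\sigma_i\in\{-1,1\}$, be a triple of signs at most one of which is positive, and let $\tau\in\mathbb C$. Geometrically (i.e., modulo the action of $\mathrm{SU}(2,1)$), all strongly regular triples $p_1,p_2,p_3$ with respect to $\pmb\alpha,\pmb\sigma,\tau$ are parameterized by the real semialgebraic surface $S_{\pmb\alpha,\pmb\sigma,\tau}\subset\mathbb R^3(t_1,t_2,t)$ given by the equation $$t_1^2t_2+t_1t_2^2-2t_1t_2t+c_5t_1^2+c_6t_2^2+c_1t^2+c_7t_1t_2+c_3t_1t+c_4t_2t+c_8t_1+c_9t_2+c_2t+c_{10}=0$$ and by the inequalities $$\sigma_1\sigma_2t_1>0,\quad \sigma_1\sigma_2t_1>\sigma_1\sigma_2,\quad \sigma_2\sigma_3t_2>0,\quad \sigma_2\sigma_3t_2>\sigma_2\sigma_3,\quad \sigma_1\sigma_2\sigma_3(2\,\mathrm{Re}\,\kappa+1)<0 .$$ That is, the map sending a strongly regular triple $p_1,p_2,p_3$ to $(t_1,t_2,t)=\big(\mathrm{ta}(p_1,p_2),\mathrm{ta}(p_2,p_3),\mathrm{Re}\,\eta\big)$ induces a bijection between $\mathrm{SU}(2,1)$-orbits of strongly regular triples with respect to $\pmb\alpha,\pmb\sigma,\tau$ and points of $S_{\pmb\alpha,\pmb\sigma,\tau}$.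
   Context: Let $V$ be a 3-dimensional complex vector space with a Hermitian form $\langle-,-\rangle$ (linear in the first argument) of signature $++-$. The same letter denotes a point of $\mathbb PV$ and a representative in $V$. A point $p$ has signature $\sigma p\in\{-1,0,1\}$, the sign of $\langle p,p\rangle$; it is nonisotropic if $\sigma p\ne0$. $\mathrm{SU}(2,1)$ is the group of determinant $1$ linear automorphisms of $V$ preserving the form. $\mathbb S^1\subset\mathbb C$ is the unit circle and $\Omega$ the set of cube roots of unity. For nonisotropic $p$ and $\alpha\in\mathbb S^1$, $R_\alpha^p:x\mapsto(\alpha^{-2}-\alpha)\frac{\langle x,p\rangle}{\langle p,p\rangle}p+\alpha x$, an element of $\mathrm{SU}(2,1)$. The tance is $\mathrm{ta}(p,q)=\frac{\langle p,q\rangle\langle q,p\rangle}{\langle p,p\rangle\langle q,q\rangle}$. A triple $p_1,p_2,p_3$ of nonisotropic points of $\mathbb PV$ is strongly regular with respect to $\pmb\alpha,\pmb\sigma,\tau$ if $\sigma p_i=\sigma_i$ for $i=1,2,3$; $p_1,p_2,p_3$ are pairwise distinct; $p_2$ is orthogonal neither to $p_1$ nor to $p_3$; $p_1,p_2,p_3$ do not lie in a same complex projective line; and $\mathrm{tr}\,R_{\alpha_3}^{p_3}R_{\alpha_2}^{p_2}R_{\alpha_1}^{p_1}=\tau$. For such a triple, $\eta:=\frac{g_{12}g_{23}g_{31}}{g_{11}g_{22}g_{33}}$ with $g_{ij}=\langle p_i,p_j\rangle$. The constants are $$\kappa:=\frac{\tau-\alpha_1^{-2}\alpha_2\alpha_3-\alpha_1\alpha_2^{-2}\alpha_3-\alpha_1\alpha_2\alpha_3^{-2}}{(\alpha_1^{-2}-\alpha_1)(\alpha_2^{-2}-\alpha_2)(\alpha_3^{-2}-\alpha_3)},\qquad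 \chi_i:=\mathrm{Im}\Big(\frac{\alpha_i}{\alpha_i^{-2}-\alpha_i}\Big),$$ $c_1=1+4\chi_2^2$, $c_2=-4\chi_2(2\chi_2\mathrm{Re}\,\kappa+\mathrm{Im}\,\kappa)$, $c_3=4\chi_2(\chi_3-\chi_2)$, $c_4=4\chi_2(\chi_1-\chi_2)$, $c_5=(\chi_3-\chi_2)^2$, $c_6=(\chi_1-\chi_2)^2$, $c_7=2\big((\chi_1-\chi_2)(\chi_3-\chi_2)+\mathrm{Re}\,\kappa\big)$, $c_8=2(\chi_2-\chi_3)(2\chi_2\mathrm{Re}\,\kappa+\mathrm{Im}\,\kappa)$, $c_9=2(\chi_2-\chi_1)(2\chi_2\mathrm{Re}\,\kappa+\mathrm{Im}\,\kappa)$, $c_{10}=(2\chi_2\mathrm{Re}\,\kappa+\mathrm{Im}\,\kappa)^2$. *)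

theory Defs
  imports "HOL-Analysis.Analysis"
begin

section \<open>Hermitian forms and the group SU(2,1)\<close>

text \<open>The space \<open>V\<close> is \<open>complex ^ 3\<close>, a complex vector space through \<open>(*s)\<close>;
  the Hermitian form \<open>h\<close> on it is arbitrary of signature \<open>++-\<close>.\<close>

type_synonym form = "complex ^ 3 \<Rightarrow> complex ^ 3 \<Rightarrow> complex"

definition hermitian_form :: "form \<Rightarrow> bool" where
  "hermitian_form h \<longleftrightarrow>
     (\<forall>x y z. h (x + y) z = h x z + h y z) \<and>
     (\<forall>c x z. h (c *s x) z = c * h x z) \<and>
     (\<forall>x y. h y x = cnj (h x y))"

definition signature_ppm :: "form \<Rightarrow> bool" where
  "signature_ppm h \<longleftrightarrow>
     (\<exists>e1 e2 e3. vec.span {e1, e2, e3} = UNIV \<and>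
        h e1 e1 = 1 \<and> h e2 e2 = 1 \<and> h e3 e3 = - 1 \<and>
        h e1 e2 = 0 \<and> h e1 e3 = 0 \<and> h e2 e3 = 0)"

definition SU21 :: "form \<Rightarrow> (complex ^ 3 \<Rightarrow> complex ^ 3) set" where
  "SU21 h = {f. Vector_Spaces.linear (*s) (*s) f \<and> det (matrix f) = 1 \<and>
                (\<forall>x y. h (f x) (f y) = h x y)}"

definition reflection :: "form \<Rightarrow> complex \<Rightarrow> complex ^ 3 \<Rightarrow> complex ^ 3 \<Rightarrow> complex ^ 3" where
  "reflection h \<alpha> p x = ((\<alpha> powi (-2) - \<alpha>) * (h x p / h p p)) *s p + \<alpha> *s x"

text \<open>For a Hermitian form \<open>h x x\<close> is real, and so is the tance (see \<open>tance_real\<close>).\<close>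

definition point_sign :: "form \<Rightarrow> complex ^ 3 \<Rightarrow> real" where
  "point_sign h p = sgn (Re (h p p))"

definition tance :: "form \<Rightarrow> complex ^ 3 \<Rightarrow> complex ^ 3 \<Rightarrow> complex" where
  "tance h p q = (h p q * h q p) / (h p p * h q q)"

definition eta :: "form \<Rightarrow> complex ^ 3 \<Rightarrow> complex ^ 3 \<Rightarrow> complex ^ 3 \<Rightarrow> complex" where
  "eta h p1 p2 p3 = (h p1 p2 * h p2 p3 * h p3 p1) / (h p1 p1 * h p2 p2 * h p3 p3)"


section \<open>The projective plane\<close>

text \<open>A point of \<open>\<PP>V\<close> is a one-dimensional linear subspace of \<open>V\<close>. The function \<open>rep\<close> picks a
  representative; the quantities above do not depend on this choice
  (\<open>point_sign_rep\<close>, \<open>reflection_rep\<close>, \<open>tance_rep\<close>, \<open>eta_rep\<close>, \<open>orthogonal_rep\<close>).\<close>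

type_synonym point = "(complex ^ 3) set"

definition proj_plane :: "point set" where
  "proj_plane = {vec.span {v} | v. v \<noteq> 0}"

definition rep :: "point \<Rightarrow> complex ^ 3" where
  "rep p = (SOME v. v \<in> p \<and> v \<noteq> 0)"

text \<open>Complex projective lines are the projectivizations of two-dimensional subspaces.\<close>

definition on_common_line :: "point \<Rightarrow> point \<Rightarrow> point \<Rightarrow> bool" where
  "on_common_line p1 p2 p3 \<longleftrightarrow>
     (\<exists>W. vec.subspace W \<and> vec.dim W = 2 \<and> p1 \<subseteq> W \<and> p2 \<subseteq> W \<and> p3 \<subseteq> W)"

lemma rep_props:
  assumes "p \<in> proj_plane"
  shows "rep p \<in> p" "rep p \<noteq> 0"
proof -
  from assms have "\<exists>v. v \<in> p \<and> v \<noteq> 0"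
    by (auto simp: proj_plane_def intro: vec.span_base)
  then have "rep p \<in> p \<and> rep p \<noteq> 0"
    unfolding rep_def by (rule someI_ex)
  then show "rep p \<in> p" "rep p \<noteq> 0" by auto
qed

lemma rep_multiple:
  assumes "p \<in> proj_plane" "v \<in> p" "v \<noteq> 0"
  obtains c where "c \<noteq> 0" "rep p = c *s v"
proof -
  obtain w where p: "p = vec.span {w}"
    using assms(1) by (auto simp: proj_plane_def)
  obtain a where a: "v = a *s w" using assms(2) by (auto simp: p vec.span_singleton)
  obtain b where b: "rep p = b *s w"
    using rep_props(1)[OF assms(1)] by (auto simp: p vec.span_singleton)
  have "a \<noteq> 0" using a assms(3) by auto
  moreover have "b \<noteq> 0" using b rep_props(2)[OF assms(1)] by auto
  ultimately show thesis using a b by (intro that[of "b / a"]) auto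
qed

lemma hermitian_formD:
  assumes "hermitian_form h"
  shows "h (x + y) z = h x z + h y z" "h (c *s x) z = c * h x z" "h y x = cnj (h x y)"
    "h x (c *s y) = cnj c * h x y"
proof -
  show "h (x + y) z = h x z + h y z" "h (c *s x) z = c * h x z"
    using assms unfolding hermitian_form_def by blast+
  have sym: "h v u = cnj (h u v)" for u v
    using assms unfolding hermitian_form_def by blast
  show "h y x = cnj (h x y)" by (rule sym)
  have "h x (c *s y) = cnj (h (c *s y) x)" by (rule sym)
  also have "h (c *s y) x = c * h y x"
    using assms unfolding hermitian_form_def by blast
  also have "cnj (c * h y x) = cnj c * h x y"
    unfolding complex_cnj_mult sym[of x y, symmetric] ..
  finally show "h x (c *s y) = cnj c * h x y" .
qed

lemma tance_real:
  assumes "hermitian_form h"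
  shows "tance h p q \<in> \<real>"
proof -
  have "cnj (h x y) = h y x" for x y
    using hermitian_formD(3)[OF assms, of x y] by simp
  then have "cnj (tance h p q) = tance h p q"
    unfolding tance_def by (simp only: complex_cnj_divide complex_cnj_mult mult.commute)
  then show ?thesis by (simp only: Reals_cnj_iff)
qed

lemma point_sign_rep:
  assumes "hermitian_form h" "p \<in> proj_plane" "v \<in> p" "v \<noteq> 0"
  shows "point_sign h (rep p) = point_sign h v"
proof -
  obtain c where c: "c \<noteq> 0" "rep p = c *s v" using rep_multiple[OF assms(2-4)] by blast
  have "h (rep p) (rep p) = (c * cnj c) * h v v"
    unfolding c hermitian_formD(2,4)[OF assms(1)] by (simp only: mult_ac)
  also have "c * cnj c = of_real ((cmod c)\<^sup>2)" by (rule complex_norm_square[symmetric])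
  finally have "Re (h (rep p) (rep p)) = (cmod c)\<^sup>2 * Re (h v v)" by simp
  then show ?thesis using c by (simp add: point_sign_def sgn_mult)
qed

lemma orthogonal_rep:
  assumes "hermitian_form h" "p \<in> proj_plane" "v \<in> p" "v \<noteq> 0" "q \<in> proj_plane" "w \<in> q" "w \<noteq> 0"
  shows "h (rep p) (rep q) = 0 \<longleftrightarrow> h v w = 0"
proof -
  obtain c where c: "c \<noteq> 0" "rep p = c *s v" using rep_multiple[OF assms(2-4)] by blast
  obtain d where d: "d \<noteq> 0" "rep q = d *s w" using rep_multiple[OF assms(5-7)] by blast
  show ?thesis
    unfolding c d hermitian_formD(2,4)[OF assms(1)] using c(1) d(1) by simp
qed

lemma reflection_rep:
  assumes "hermitian_form h" "p \<in> proj_plane" "v \<in> p" "v \<noteq> 0"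
  shows "reflection h \<alpha> (rep p) = reflection h \<alpha> v"
proof
  fix x
  obtain c where c: "c \<noteq> 0" "rep p = c *s v" using rep_multiple[OF assms(2-4)] by blast
  have *: "(h x (rep p) / h (rep p) (rep p)) * c = h x v / h v v"
    unfolding c hermitian_formD(2,4)[OF assms(1)] using c(1) by simp
  have "reflection h \<alpha> (rep p) x =
      ((\<alpha> powi (-2) - \<alpha>) * ((h x (rep p) / h (rep p) (rep p)) * c)) *s v + \<alpha> *s x"
    unfolding reflection_def by (subst (3) c(2)) (simp only: vector_smult_assoc mult.assoc)
  then show "reflection h \<alpha> (rep p) x = reflection h \<alpha> v x"
    by (simp only: * reflection_def)
qed

lemma tance_rep:
  assumes "hermitian_form h" "p \<in> proj_plane" "v \<in> p" "v \<noteq> 0" "q \<in> proj_plane" "w \<in> q" "w \<noteq> 0"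
  shows "tance h (rep p) (rep q) = tance h v w"
proof -
  obtain c where c: "c \<noteq> 0" "rep p = c *s v" using rep_multiple[OF assms(2-4)] by blast
  obtain d where d: "d \<noteq> 0" "rep q = d *s w" using rep_multiple[OF assms(5-7)] by blast
  have "tance h (rep p) (rep q) =
      ((c * cnj c * d * cnj d) * (h v w * h w v)) / ((c * cnj c * d * cnj d) * (h v v * h w w))"
    unfolding tance_def c d hermitian_formD(2,4)[OF assms(1)] by (simp only: mult_ac)
  then show ?thesis using c(1) d(1) by (simp add: tance_def)
qed

lemma eta_rep:
  assumes "hermitian_form h" "p1 \<in> proj_plane" "v1 \<in> p1" "v1 \<noteq> 0"
    "p2 \<in> proj_plane" "v2 \<in> p2" "v2 \<noteq> 0" "p3 \<in> proj_plane" "v3 \<in> p3" "v3 \<noteq> 0"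
  shows "eta h (rep p1) (rep p2) (rep p3) = eta h v1 v2 v3"
proof -
  obtain a where a: "a \<noteq> 0" "rep p1 = a *s v1" using rep_multiple[OF assms(2-4)] by blast
  obtain b where b: "b \<noteq> 0" "rep p2 = b *s v2" using rep_multiple[OF assms(5-7)] by blast
  obtain c where c: "c \<noteq> 0" "rep p3 = c *s v3" using rep_multiple[OF assms(8-10)] by blast
  let ?k = "a * cnj a * b * cnj b * c * cnj c"
  have "eta h (rep p1) (rep p2) (rep p3) =
      (?k * (h v1 v2 * h v2 v3 * h v3 v1)) / (?k * (h v1 v1 * h v2 v2 * h v3 v3))"
    unfolding eta_def a b c hermitian_formD(2,4)[OF assms(1)] by (simp only: mult_ac)
  then show ?thesis using a(1) b(1) c(1) by (simp add: eta_def)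
qed


section \<open>Strongly regular triples\<close>

definition strongly_regular ::
  "form \<Rightarrow> complex \<times> complex \<times> complex \<Rightarrow> real \<times> real \<times> real \<Rightarrow> complex \<Rightarrow>
     point \<times> point \<times> point \<Rightarrow> bool" where
  "strongly_regular h = (\<lambda>(\<alpha>1, \<alpha>2, \<alpha>3) (\<sigma>1, \<sigma>2, \<sigma>3) \<tau> (p1, p2, p3).
     p1 \<in> proj_plane \<and> p2 \<in> proj_plane \<and> p3 \<in> proj_plane \<and>
     point_sign h (rep p1) \<noteq> 0 \<and> point_sign h (rep p2) \<noteq> 0 \<and> point_sign h (rep p3) \<noteq> 0 \<and>
     point_sign h (rep p1) = \<sigma>1 \<and> point_sign h (rep p2) = \<sigma>2 \<and> point_sign h (rep p3) = \<sigma>3 \<and>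
     p1 \<noteq> p2 \<and> p2 \<noteq> p3 \<and> p1 \<noteq> p3 \<and>
     h (rep p2) (rep p1) \<noteq> 0 \<and> h (rep p2) (rep p3) \<noteq> 0 \<and>
     \<not> on_common_line p1 p2 p3 \<and>
     trace (matrix (reflection h \<alpha>3 (rep p3) \<circ> reflection h \<alpha>2 (rep p2) \<circ>
                    reflection h \<alpha>1 (rep p1))) = \<tau>)"

definition SU21_orbit :: "form \<Rightarrow> point \<times> point \<times> point \<Rightarrow> (point \<times> point \<times> point) set" where
  "SU21_orbit h = (\<lambda>(p1, p2, p3). {(f ` p1, f ` p2, f ` p3) | f. f \<in> SU21 h})"

definition parameters :: "form \<Rightarrow> point \<times> point \<times> point \<Rightarrow> real \<times> real \<times> real" where
  "parameters h = (\<lambda>(p1, p2, p3).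
     (Re (tance h (rep p1) (rep p2)), Re (tance h (rep p2) (rep p3)),
      Re (eta h (rep p1) (rep p2) (rep p3))))"


section \<open>The surface\<close>

definition kappa :: "complex \<times> complex \<times> complex \<Rightarrow> complex \<Rightarrow> complex" where
  "kappa = (\<lambda>(\<alpha>1, \<alpha>2, \<alpha>3) \<tau>.
     (\<tau> - \<alpha>1 powi (-2) * \<alpha>2 * \<alpha>3 - \<alpha>1 * \<alpha>2 powi (-2) * \<alpha>3 - \<alpha>1 * \<alpha>2 * \<alpha>3 powi (-2)) /
     ((\<alpha>1 powi (-2) - \<alpha>1) * (\<alpha>2 powi (-2) - \<alpha>2) * (\<alpha>3 powi (-2) - \<alpha>3)))"

definition chi :: "complex \<Rightarrow> real" where
  "chi \<alpha> = Im (\<alpha> / (\<alpha> powi (-2) - \<alpha>))"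

definition surface ::
  "complex \<times> complex \<times> complex \<Rightarrow> real \<times> real \<times> real \<Rightarrow> complex \<Rightarrow> (real \<times> real \<times> real) set" where
  "surface = (\<lambda>(\<alpha>1, \<alpha>2, \<alpha>3) (\<sigma>1, \<sigma>2, \<sigma>3) \<tau>.
     (let \<kappa> = kappa (\<alpha>1, \<alpha>2, \<alpha>3) \<tau>;
          \<chi>1 = chi \<alpha>1; \<chi>2 = chi \<alpha>2; \<chi>3 = chi \<alpha>3;
          c1 = 1 + 4 * \<chi>2\<^sup>2;
          c2 = - 4 * \<chi>2 * (2 * \<chi>2 * Re \<kappa> + Im \<kappa>);
          c3 = 4 * \<chi>2 * (\<chi>3 - \<chi>2);
          c4 = 4 * \<chi>2 * (\<chi>1 - \<chi>2);
          c5 = (\<chi>3 - \<chi>2)\<^sup>2;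
          c6 = (\<chi>1 - \<chi>2)\<^sup>2;
          c7 = 2 * ((\<chi>1 - \<chi>2) * (\<chi>3 - \<chi>2) + Re \<kappa>);
          c8 = 2 * (\<chi>2 - \<chi>3) * (2 * \<chi>2 * Re \<kappa> + Im \<kappa>);
          c9 = 2 * (\<chi>2 - \<chi>1) * (2 * \<chi>2 * Re \<kappa> + Im \<kappa>);
          c10 = (2 * \<chi>2 * Re \<kappa> + Im \<kappa>)\<^sup>2
      in {(t1, t2, t).
            t1\<^sup>2 * t2 + t1 * t2\<^sup>2 - 2 * t1 * t2 * t + c5 * t1\<^sup>2 + c6 * t2\<^sup>2 + c1 * t\<^sup>2
              + c7 * t1 * t2 + c3 * t1 * t + c4 * t2 * t + c8 * t1 + c9 * t2 + c2 * t + c10 = 0 \<and>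
            \<sigma>1 * \<sigma>2 * t1 > 0 \<and> \<sigma>1 * \<sigma>2 * t1 > \<sigma>1 * \<sigma>2 \<and>
            \<sigma>2 * \<sigma>3 * t2 > 0 \<and> \<sigma>2 * \<sigma>3 * t2 > \<sigma>2 * \<sigma>3 \<and>
            \<sigma>1 * \<sigma>2 * \<sigma>3 * (2 * Re \<kappa> + 1) < 0}))"

end

theory Submission
  imports Defs
begin

text \<open>Write \<open>s = ta(p\<^sub>1, p\<^sub>3)\<close>. Expanding the product of the reflections into rank-one operators turns
  the trace condition into \<open>\<kappa> = \<eta> + (\<alpha>\<^sub>3 / a\<^sub>3) t\<^sub>1 + (\<alpha>\<^sub>2 / a\<^sub>2) s + (\<alpha>\<^sub>1 / a\<^sub>1) t\<^sub>2\<close>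
  with \<open>a\<^sub>i = \<alpha>\<^sub>i\<^sup>-\<^sup>2 - \<alpha>\<^sub>i\<close>. Since \<open>Re (\<alpha>\<^sub>i / a\<^sub>i) = - 1 / 2\<close>, the real part determines \<open>s\<close> and the
  imaginary part then determines \<open>Im \<eta>\<close> from \<open>t\<^sub>1, t\<^sub>2, t\<close>; the equation of the surface is the
  identity \<open>|\<eta>|\<^sup>2 = t\<^sub>1 t\<^sub>2 s\<close>, and \<open>2 Re \<kappa> + 1\<close> is the Gram determinant of the triple divided by
  \<open>g\<^sub>1\<^sub>1 g\<^sub>2\<^sub>2 g\<^sub>3\<^sub>3\<close>. After normalizing the representatives so that \<open>g\<^sub>i\<^sub>i = \<sigma>\<^sub>i\<close> and \<open>g\<^sub>1\<^sub>2, g\<^sub>2\<^sub>3 > 0\<close>, the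
  Gram matrix is a function of \<open>t\<^sub>1, t\<^sub>2, \<eta>\<close>. Triples with equal nondegenerate Gram matrices differ by
  an isometry, and a Gram matrix is realized as soon as its leading minors of order two and three
  are negative, because this forces the signature \<open>++-\<close>.\<close>

section \<open>Triples of vectors and projective lines\<close>

text \<open>Packing a triple as the columns of a matrix turns applying a linear map to it into left
  multiplication, and independence into \<open>det \<noteq> 0\<close>.\<close>

definition cols :: "complex ^ 3 \<Rightarrow> complex ^ 3 \<Rightarrow> complex ^ 3 \<Rightarrow> complex ^ 3 ^ 3" where
  "cols u v w = transpose (vector [u, v, w])"

lemma cols_mult: "cols u v w *v a = a $ 1 *s u + a $ 2 *s v + a $ 3 *s w"
  by (simp add: cols_def vec_eq_iff matrix_vector_mult_def sum_3 transpose_def mult.commute)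

lemma mult_cols: "A ** cols u v w = cols (A *v u) (A *v v) (A *v w)"
  by (simp add: cols_def vec_eq_iff matrix_matrix_mult_def matrix_vector_mult_def sum_3
      transpose_def forall_3)

lemma det_eq_0_iff_kernel:
  fixes A :: "complex ^ 'n ^ 'n"
  shows "det A = 0 \<longleftrightarrow> (\<exists>x. x \<noteq> 0 \<and> A *v x = 0)"
  using invertible_det_nz[of A] invertible_left_inverse[of A] matrix_left_invertible_ker[of A]
  by blast

lemma span_cols: "vec.span {u, v, w} = range ((*v) (cols u v w))"
proof (intro set_eqI iffI)
  fix x
  assume "x \<in> vec.span {u, v, w}"
  then obtain a b c where "x - a *s u - b *s v = c *s w"
    by (auto simp: vec.span_insert vec.span_singleton)
  then have "x = a *s u + b *s v + c *s w"
    by (simp add: algebra_simps)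
  then have "x = cols u v w *v vector [a, b, c]"
    by (simp add: cols_mult)
  then show "x \<in> range ((*v) (cols u v w))"
    by blast
next
  fix x
  assume "x \<in> range ((*v) (cols u v w))"
  then show "x \<in> vec.span {u, v, w}"
    by (auto simp: cols_mult intro: vec.span_add vec.span_scale vec.span_base)
qed

lemma det_cols_span:
  "det (cols u v w) \<noteq> 0 \<longleftrightarrow> vec.span {u, v, w} = UNIV"
  using invertible_det_nz[of "cols u v w"] invertible_right_inverse[of "cols u v w"]
    matrix_right_invertible_surjective[of "cols u v w"]
  by (simp add: span_cols)

lemma span_scaleD:
  assumes "c *s w \<in> vec.span S" "c \<noteq> (0 :: complex)"
  shows "w \<in> vec.span S"
  using vec.span_scale[OF assms(1), of "inverse c"] assms(2) by simp

text \<open>A nontrivial relation among the three vectors must have a nonzero coefficient at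
  \<open>w\<close>: otherwise \<open>v\<close> would be a multiple of \<open>u\<close>, or
  \<open>u\<close> would vanish.\<close>

lemma det_cols_eq_0:
  assumes "det (cols u v w) = 0" "u \<noteq> 0" "v \<notin> vec.span {u}"
  shows "w \<in> vec.span {u, v}"
proof (rule ccontr)
  assume w: "w \<notin> vec.span {u, v}"
  obtain x :: "complex ^ 3" where x: "x \<noteq> 0" "x $ 1 *s u + x $ 2 *s v + x $ 3 *s w = 0"
    using assms(1) by (auto simp: det_eq_0_iff_kernel cols_mult)
  have 3: "x $ 3 = 0"
  proof (rule ccontr)
    assume "x $ 3 \<noteq> 0"
    have "x $ 3 *s w = - (x $ 1 *s u + x $ 2 *s v)"
      by (rule minus_unique[OF x(2), symmetric])
    then have "x $ 3 *s w \<in> vec.span {u, v}"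
      by (simp only:) (intro vec.span_neg vec.span_add vec.span_scale vec.span_base; simp)
    then show False
      using w \<open>x $ 3 \<noteq> 0\<close> span_scaleD by blast
  qed
  have 2: "x $ 2 = 0"
  proof (rule ccontr)
    assume "x $ 2 \<noteq> 0"
    have "x $ 2 *s v = - (x $ 1 *s u)"
      using x(2) 3 minus_unique[of "x $ 1 *s u" "x $ 2 *s v"] by simp
    then have "x $ 2 *s v \<in> vec.span {u}"
      by (simp only:) (intro vec.span_neg vec.span_scale vec.span_base; simp)
    then show False
      using assms(3) \<open>x $ 2 \<noteq> 0\<close> span_scaleD by blast
  qed
  have "x $ 1 = 0"
    using x(2) 2 3 assms(2) by simp
  then show False
    using 2 3 x(1) by (simp add: vec_eq_iff forall_3)
qed

lemma det_cols_nz_imp_notin_span: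
  assumes "det (cols u v w) \<noteq> 0"
  shows "v \<notin> vec.span {u}" "w \<notin> vec.span {v}" "w \<notin> vec.span {u}"
proof -
  have kernel: "vector [a, b, c] = (0 :: complex ^ 3)" if "a *s u + b *s v + c *s w = 0" for a b c
  proof -
    have "cols u v w *v vector [a, b, c] = 0"
      using that by (simp add: cols_mult)
    then show ?thesis
      using assms det_eq_0_iff_kernel by blast
  qed
  show "v \<notin> vec.span {u}"
  proof
    assume "v \<in> vec.span {u}"
    then obtain c where "v = c *s u"
      by (auto simp: vec.span_singleton)
    then show False
      using kernel[of "- c" 1 0] by (simp add: vec_eq_iff forall_3)
  qed
  show "w \<notin> vec.span {v}"
  proof
    assume "w \<in> vec.span {v}"
    then obtain c where "w = c *s v"
      by (auto simp: vec.span_singleton)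
    then show False
      using kernel[of 0 "- c" 1] by (simp add: vec_eq_iff forall_3)
  qed
  show "w \<notin> vec.span {u}"
  proof
    assume "w \<in> vec.span {u}"
    then obtain c where "w = c *s u"
      by (auto simp: vec.span_singleton)
    then show False
      using kernel[of "- c" 0 1] by (simp add: vec_eq_iff forall_3)
  qed
qed

lemma proj_plane_eq_span:
  assumes "p \<in> proj_plane" "v \<in> p" "v \<noteq> 0"
  shows "p = vec.span {v}"
proof -
  obtain w where w: "p = vec.span {w}"
    using assms(1) by (auto simp: proj_plane_def)
  then obtain c where "v = c *s w"
    using assms(2) by (auto simp: vec.span_singleton)
  then have "v \<in> vec.span {w}" "w \<in> vec.span {v}"
    using assms(3) span_scaleD[of c w "{v}"] by (auto intro: vec.span_scale vec.span_base)
  then show ?thesis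
    using w vec.span_eq[of "{w}" "{v}"] by auto
qed

text \<open>A two-dimensional subspace cannot contain a spanning triple. Conversely, distinct points
  \<open>u\<close> and \<open>v\<close> span a plane, and a vanishing determinant puts
  \<open>w\<close> into it.\<close>

lemma on_common_line_iff:
  assumes "u \<noteq> 0" "v \<noteq> 0" "vec.span {u} \<noteq> vec.span {v}"
  shows "on_common_line (vec.span {u}) (vec.span {v}) (vec.span {w}) \<longleftrightarrow> det (cols u v w) = 0"
proof
  assume "on_common_line (vec.span {u}) (vec.span {v}) (vec.span {w})"
  then obtain W where W: "vec.subspace W" "vec.dim W = 2" "{u, v, w} \<subseteq> W"
    unfolding on_common_line_def using vec.span_superset[of "{_}"] by (meson insert_subset empty_subsetI subset_trans)
  have "vec.span {u, v, w} \<noteq> UNIV"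
  proof
    assume "vec.span {u, v, w} = UNIV"
    then have "W = UNIV"
      using vec.span_minimal[OF W(3,1)] by blast
    then show False
      using W(2) vec_dim_card[where 'a = complex and 'n = 3] by simp
  qed
  then show "det (cols u v w) = 0"
    using det_cols_span by blast
next
  assume "det (cols u v w) = 0"
  have v: "v \<notin> vec.span {u}"
  proof
    assume "v \<in> vec.span {u}"
    moreover have "vec.span {u} \<in> proj_plane"
      using assms(1) by (auto simp: proj_plane_def)
    ultimately show False
      using proj_plane_eq_span assms(2,3) by blast
  qed
  then have w: "w \<in> vec.span {u, v}"
    using det_cols_eq_0 \<open>det (cols u v w) = 0\<close> assms(1) by blast
  have "vec.independent {v, u}"
    using v assms(1) by (simp add: vec.independent_insert)
  moreover have "v \<noteq> u"
    using assms(3) by blast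
  ultimately have "vec.dim {v, u} = 2"
    using vec.dim_eq_card_independent[of "{v, u}"] by simp
  then have "vec.dim (vec.span {u, v}) = 2"
    by (simp add: insert_commute)
  then show "on_common_line (vec.span {u}) (vec.span {v}) (vec.span {w})"
    unfolding on_common_line_def
    using w by (intro exI[of _ "vec.span {u, v}"] conjI)
      (simp_all add: vec.span_minimal vec.span_base)
qed

lemma span_in_proj_plane: "v \<noteq> 0 \<Longrightarrow> vec.span {v} \<in> proj_plane"
  by (auto simp: proj_plane_def)

lemma span_scale_singleton:
  assumes "c \<noteq> (0 :: complex)"
  shows "vec.span {c *s v} = vec.span {v :: complex ^ 3}"
  using vec.span_image_scale[of "{v}" "\<lambda>_. c"] assms by simp

section \<open>Hermitian forms and their isometries\<close>

text \<open>The determinant of the Gram matrix of the triple, written out by the Leibniz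
  formula.\<close>

definition gram :: "form \<Rightarrow> complex ^ 3 \<Rightarrow> complex ^ 3 \<Rightarrow> complex ^ 3 \<Rightarrow> complex" where
  "gram h u v w =
     h u u * h v v * h w w + h u v * h v w * h w u + h u w * h w v * h v u
     - h u u * (h v w * h w v) - h v v * (h u w * h w u) - h w w * (h u v * h v u)"

locale hermitian_space =
  fixes h :: form
  assumes hermitian: "hermitian_form h"
begin

lemma h_add_left: "h (x + y) z = h x z + h y z"
  and h_scale_left: "h (c *s x) y = c * h x y"
  and h_scale_right: "h x (c *s y) = cnj c * h x y"
  and h_cnj: "cnj (h x y) = h y x"
  using hermitian_formD[OF hermitian] by metis+

lemma h_add_right: "h x (y + z) = h x y + h x z"
  using h_cnj[of "y + z" x] by (simp add: h_add_left h_cnj)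

lemmas h_simps = h_add_left h_add_right h_scale_left h_scale_right

lemma h_zero_left: "h 0 y = 0"
  using h_scale_left[of 0 0 y] by simp

lemma h_diff_left: "h (x - y) z = h x z - h y z"
  using h_add_left[of "x - y" y z] by simp

lemma h_diff_right: "h x (y - z) = h x y - h x z"
  using h_add_right[of x "y - z" z] by simp

lemma h_self_real: "h x x = of_real (Re (h x x))"
  using h_cnj[of x x] by (simp add: complex_eq_iff)

lemma h_mult_swap: "h x y * h y x = of_real ((cmod (h x y))\<^sup>2)"
  by (simp only: complex_norm_square h_cnj)

lemma h_sum_left: "h (sum f S) y = (\<Sum>i\<in>S. h (f i) y)"
  by (induction S rule: infinite_finite_induct) (simp_all add: h_zero_left h_add_left)

section \<open>The group SU(2,1) and its orbits\<close>

lemma SU21_iff: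
  "f \<in> SU21 h \<longleftrightarrow> (\<exists>A. f = (*v) A \<and> det A = 1 \<and> (\<forall>x y. h (A *v x) (A *v y) = h x y))"
proof
  assume f: "f \<in> SU21 h"
  then have "f = (*v) (matrix f)"
    by (auto simp: SU21_def matrix_works)
  with f show "\<exists>A. f = (*v) A \<and> det A = 1 \<and> (\<forall>x y. h (A *v x) (A *v y) = h x y)"
    unfolding SU21_def by (intro exI[of _ "matrix f"]) (simp add: fun_eq_iff)
next
  assume "\<exists>A. f = (*v) A \<and> det A = 1 \<and> (\<forall>x y. h (A *v x) (A *v y) = h x y)"
  then show "f \<in> SU21 h"
    by (auto simp: SU21_def)
qed

lemma id_in_SU21: "id \<in> SU21 h"
  unfolding SU21_iff by (intro exI[of _ "mat 1"]) (simp add: fun_eq_iff)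

lemma comp_in_SU21:
  assumes "f \<in> SU21 h" "g \<in> SU21 h"
  shows "f \<circ> g \<in> SU21 h"
proof -
  obtain A B where "f = (*v) A" "det A = 1" "\<And>x y. h (A *v x) (A *v y) = h x y"
    and "g = (*v) B" "det B = 1" "\<And>x y. h (B *v x) (B *v y) = h x y"
    using assms unfolding SU21_iff by blast
  then show ?thesis
    unfolding SU21_iff
    by (intro exI[of _ "A ** B"])
      (simp add: fun_eq_iff det_mul flip: matrix_vector_mul_assoc)
qed

lemma SU21_inverse:
  assumes "f \<in> SU21 h"
  obtains g where "g \<in> SU21 h" "f \<circ> g = id" "g \<circ> f = id"
proof -
  obtain A where A: "f = (*v) A" "det A = 1" "\<And>x y. h (A *v x) (A *v y) = h x y"
    using assms unfolding SU21_iff by blast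
  have "invertible A"
    using A(2) by (simp add: invertible_det_nz)
  then obtain B where B: "A ** B = mat 1" "B ** A = mat 1"
    unfolding invertible_def by blast
  have "det B = 1"
    using arg_cong[OF B(1), of det] A(2) by (simp add: det_mul)
  moreover have "h (B *v x) (B *v y) = h x y" for x y
    using A(3)[of "B *v x" "B *v y"] by (simp add: matrix_vector_mul_assoc B)
  ultimately have "(*v) B \<in> SU21 h"
    unfolding SU21_iff by blast
  then show thesis
    by (rule that) (simp_all add: A(1) fun_eq_iff matrix_vector_mul_assoc B)
qed

lemma SU21_scale:
  assumes "f \<in> SU21 h"
  shows "f (c *s x) = c *s f x"
  using assms unfolding SU21_iff by (auto simp: vector_scalar_commute)

lemma SU21_image_span:
  assumes "f \<in> SU21 h"
  shows "f ` vec.span {x} = vec.span {f x}"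
  by (auto simp: vec.span_singleton SU21_scale[OF assms] image_image)

lemma SU21_orbit_image_subset:
  assumes "f \<in> SU21 h"
  shows "SU21_orbit h (f ` p1, f ` p2, f ` p3) \<subseteq> SU21_orbit h (p1, p2, p3)"
proof
  fix P
  assume "P \<in> SU21_orbit h (f ` p1, f ` p2, f ` p3)"
  then obtain g where "g \<in> SU21 h" "P = (g ` f ` p1, g ` f ` p2, g ` f ` p3)"
    by (auto simp: SU21_orbit_def)
  then have "g \<circ> f \<in> SU21 h" "P = ((g \<circ> f) ` p1, (g \<circ> f) ` p2, (g \<circ> f) ` p3)"
    by (simp_all add: comp_in_SU21 assms image_comp)
  then show "P \<in> SU21_orbit h (p1, p2, p3)"
    unfolding SU21_orbit_def by blast
qed

lemma SU21_orbit_image: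
  assumes "f \<in> SU21 h"
  shows "SU21_orbit h (f ` p1, f ` p2, f ` p3) = SU21_orbit h (p1, p2, p3)"
proof
  obtain g where g: "g \<in> SU21 h" "f \<circ> g = id" "g \<circ> f = id"
    using SU21_inverse[OF assms] by blast
  then have "g ` f ` p = p" for p
    by (simp add: image_comp)
  then show "SU21_orbit h (p1, p2, p3) \<subseteq> SU21_orbit h (f ` p1, f ` p2, f ` p3)"
    using SU21_orbit_image_subset[OF g(1), of "f ` p1" "f ` p2" "f ` p3"] by simp
qed (rule SU21_orbit_image_subset[OF assms])

end

text \<open>Scaling a 3 by 3 matrix by \<open>c\<close> multiplies its determinant by
  \<open>c ^ 3\<close>, so this factor normalizes the determinant of an isometry to one.\<close>

lemma unimodular_cube_root:
  fixes z :: complex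
  assumes "cmod z = 1"
  obtains c where "cmod c = 1" "c ^ 3 * z = 1"
proof -
  define c where "c = cis (- Arg z / 3)"
  have "c ^ 3 = cis (- Arg z)"
    unfolding c_def by (simp add: Complex.DeMoivre)
  moreover have "z = cis (Arg z)"
    using assms by (metis rcis_cmod_Arg rcis_def mult_1 of_real_1)
  ultimately have "c ^ 3 * z = 1"
    by (metis cis_mult cis_zero add.left_inverse)
  then show thesis
    using that[of c] by (simp add: c_def)
qed

section \<open>Consequences of the signature\<close>

locale signature_space = hermitian_space +
  assumes signature: "signature_ppm h"
begin

lemma obtain_frame:
  obtains E where "det E \<noteq> 0"
    "\<And>x y. h (E *v x) (E *v y) = x $ 1 * cnj (y $ 1) + x $ 2 * cnj (y $ 2) - x $ 3 * cnj (y $ 3)"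
proof -
  obtain e1 e2 e3 where e: "vec.span {e1, e2, e3} = UNIV"
    "h e1 e1 = 1" "h e2 e2 = 1" "h e3 e3 = - 1" "h e1 e2 = 0" "h e1 e3 = 0" "h e2 e3 = 0"
    using signature unfolding signature_ppm_def by blast
  have "h e2 e1 = 0" "h e3 e1 = 0" "h e3 e2 = 0"
    using e h_cnj by (metis complex_cnj_zero)+
  then show thesis
    using e that[of "cols e1 e2 e3"] by (simp add: det_cols_span cols_mult h_simps)
qed

text \<open>In an orthonormal frame the Gram matrix is \<open>X\<close> transposed times diag(1, 1,
  -1) times the conjugate of \<open>X\<close>, with \<open>X\<close> the coordinate matrix. Its
  determinant is minus the squared modulus of \<open>det X\<close>; the change of basis contributes
  \<open>k\<close>.\<close>

lemma gram_det:
  obtains k where "k > 0"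
    "\<And>u v w. gram h u v w = - of_real (k * (cmod (det (cols u v w)))\<^sup>2)"
proof -
  obtain E where E: "det E \<noteq> 0"
    "\<And>x y. h (E *v x) (E *v y) = x $ 1 * cnj (y $ 1) + x $ 2 * cnj (y $ 2) - x $ 3 * cnj (y $ 3)"
    using obtain_frame by blast
  have "invertible E"
    using E(1) by (simp add: invertible_det_nz)
  then obtain B where B: "E ** B = mat 1"
    unfolding invertible_def by blast
  let ?k = "1 / (cmod (det E))\<^sup>2"
  have "gram h u v w = - of_real (?k * (cmod (det (cols u v w)))\<^sup>2)" for u v w
  proof -
    have *: "x = E *v (B *v x)" for x
      by (simp add: matrix_vector_mul_assoc B)
    define x y z where "x = B *v u" and "y = B *v v" and "z = B *v w"
    have uvw: "u = E *v x" "v = E *v y" "w = E *v z"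
      using * by (simp_all add: x_def y_def z_def)
    have "gram h u v w = - (det (cols x y z) * cnj (det (cols x y z)))"
      unfolding uvw gram_def E(2) det_3
      by (simp add: cols_def transpose_def) (simp add: algebra_simps)
    also have "\<dots> = - of_real ((cmod (det (cols x y z)))\<^sup>2)"
      by (simp only: complex_norm_square)
    also have "det (cols u v w) = det E * det (cols x y z)"
      unfolding uvw by (simp add: det_mul flip: mult_cols)
    then have "(cmod (det (cols x y z)))\<^sup>2 = ?k * (cmod (det (cols u v w)))\<^sup>2"
      using E(1) by (simp add: norm_mult power_mult_distrib)
    finally show ?thesis .
  qed
  then show thesis
    using that[of ?k] E(1) by simp
qed

text \<open>Independence becomes a sign condition: this links the requirement that the points lie on
  no common line with the last inequality of the surface.\<close>

lemma Re_gram_neg_iff: "Re (gram h u v w) < 0 \<longleftrightarrow> det (cols u v w) \<noteq> 0"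
proof -
  obtain k where "k > 0" "\<And>u v w. gram h u v w = - of_real (k * (cmod (det (cols u v w)))\<^sup>2)"
    using gram_det by blast
  then show ?thesis
    by (simp add: zero_less_mult_iff)
qed

text \<open>The orthogonal complement of a negative vector is positive definite. In coordinates,
  orthogonality expresses the product of the third entries by the first two, and the Cauchy-Schwarz
  inequality in two dimensions bounds it.\<close>

lemma orthogonal_to_negative:
  assumes "Re (h v v) < 0" "h x v = 0" "x \<noteq> 0"
  shows "Re (h x x) > 0"
proof -
  obtain E where E: "det E \<noteq> 0"
    "\<And>x y. h (E *v x) (E *v y) = x $ 1 * cnj (y $ 1) + x $ 2 * cnj (y $ 2) - x $ 3 * cnj (y $ 3)"
    using obtain_frame by blast
  have "invertible E"
    using E(1) by (simp add: invertible_det_nz)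
  then obtain B where B: "E ** B = mat 1"
    unfolding invertible_def by blast
  have *: "x = E *v (B *v x)" for x
    by (simp add: matrix_vector_mul_assoc B)
  define a b where "a = B *v x" and "b = B *v v"
  have ab: "x = E *v a" "v = E *v b"
    using * by (simp_all add: a_def b_def)
  have Re_self: "Re (h (E *v y) (E *v y)) = (cmod (y $ 1))\<^sup>2 + (cmod (y $ 2))\<^sup>2 - (cmod (y $ 3))\<^sup>2" for y
    by (simp add: E(2) cmod_power2) (simp add: power2_eq_square)
  have b: "(cmod (b $ 1))\<^sup>2 + (cmod (b $ 2))\<^sup>2 < (cmod (b $ 3))\<^sup>2"
    using assms(1) by (simp add: ab Re_self)
  have "a $ 3 * cnj (b $ 3) = a $ 1 * cnj (b $ 1) + a $ 2 * cnj (b $ 2)"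
    using assms(2) by (simp add: ab E(2))
  then have "cmod (a $ 3) * cmod (b $ 3) \<le> cmod (a $ 1) * cmod (b $ 1) + cmod (a $ 2) * cmod (b $ 2)"
    by (metis complex_mod_cnj norm_mult norm_triangle_ineq)
  then have "(cmod (a $ 3) * cmod (b $ 3))\<^sup>2 \<le> (cmod (a $ 1) * cmod (b $ 1) + cmod (a $ 2) * cmod (b $ 2))\<^sup>2"
    by (intro power_mono) simp_all
  \<comment> \<open>Lagrange's identity: the two sides differ by the square supplied here.\<close>
  also have "\<dots> \<le> ((cmod (a $ 1))\<^sup>2 + (cmod (a $ 2))\<^sup>2) * ((cmod (b $ 1))\<^sup>2 + (cmod (b $ 2))\<^sup>2)"
    using zero_le_power2[of "cmod (a $ 1) * cmod (b $ 2) - cmod (a $ 2) * cmod (b $ 1)"]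
    by (simp add: power2_eq_square algebra_simps)
  finally have le: "(cmod (a $ 3))\<^sup>2 * (cmod (b $ 3))\<^sup>2 \<le>
      ((cmod (a $ 1))\<^sup>2 + (cmod (a $ 2))\<^sup>2) * ((cmod (b $ 1))\<^sup>2 + (cmod (b $ 2))\<^sup>2)"
    by (simp add: power_mult_distrib)
  have b3: "0 < (cmod (b $ 3))\<^sup>2"
    using b by (smt (verit) zero_le_power2)
  \<comment> \<open>Strict positivity of this factor keeps the inequality for \<open>b\<close>
    strict after multiplication.\<close>
  have "(cmod (a $ 1))\<^sup>2 + (cmod (a $ 2))\<^sup>2 > 0"
  proof (rule ccontr)
    assume "\<not> ?thesis"
    then have "(cmod (a $ 1))\<^sup>2 + (cmod (a $ 2))\<^sup>2 = 0"
      by (smt (verit) zero_le_power2)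
    then have "(cmod (a $ 3))\<^sup>2 * (cmod (b $ 3))\<^sup>2 \<le> 0" "a $ 1 = 0" "a $ 2 = 0"
      using le by (simp_all add: add_nonneg_eq_0_iff)
    then have "a = 0"
      using b3 by (simp add: vec_eq_iff forall_3 mult_le_0_iff)
    then show False
      using assms(3) ab by simp
  qed
  then have "((cmod (a $ 1))\<^sup>2 + (cmod (a $ 2))\<^sup>2) * ((cmod (b $ 1))\<^sup>2 + (cmod (b $ 2))\<^sup>2)
      < ((cmod (a $ 1))\<^sup>2 + (cmod (a $ 2))\<^sup>2) * (cmod (b $ 3))\<^sup>2"
    using b by (rule mult_strict_left_mono[rotated])
  with le have "(cmod (a $ 3))\<^sup>2 * (cmod (b $ 3))\<^sup>2 < ((cmod (a $ 1))\<^sup>2 + (cmod (a $ 2))\<^sup>2) * (cmod (b $ 3))\<^sup>2"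
    by linarith
  then have "(cmod (a $ 3))\<^sup>2 < (cmod (a $ 1))\<^sup>2 + (cmod (a $ 2))\<^sup>2"
    using b3 by simp
  then show ?thesis
    by (simp add: ab Re_self)
qed

text \<open>The component \<open>w\<close> of \<open>v\<close> orthogonal to \<open>u\<close> is
  nonzero, hence positive. Expanding \<open>h w w\<close> and multiplying by the negative number
  \<open>h u u\<close> gives the Cauchy-Schwarz inequality in reversed direction.\<close>

lemma negative_points_cauchy_schwarz:
  assumes "Re (h u u) < 0" "Re (h v v) < 0" "v \<notin> vec.span {u}"
  shows "Re (h u u) * Re (h v v) < (cmod (h u v))\<^sup>2"
proof -
  define w where "w = v - (h v u / h u u) *s u"
  have nz: "h u u \<noteq> 0"
    using assms(1) by auto
  have "w \<noteq> 0"
  proof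
    assume "w = 0"
    then have "v = (h v u / h u u) *s u"
      by (simp add: w_def)
    then show False
      using assms(3) by (metis vec.span_base vec.span_scale singletonI)
  qed
  moreover have wu: "h w u = 0"
    using nz by (simp add: w_def h_diff_left h_scale_left)
  ultimately have "Re (h w w) > 0"
    using orthogonal_to_negative[OF assms(1)] by blast
  moreover have "h w w = h v v - h u v * h v u / h u u"
    using wu by (simp add: w_def h_diff_left h_diff_right h_scale_left h_scale_right)
  then have "h w w = of_real (Re (h v v) - (cmod (h u v))\<^sup>2 / Re (h u u))"
    unfolding h_mult_swap using h_self_real[of u] h_self_real[of v] by simp
  ultimately have "Re (h v v) - (cmod (h u v))\<^sup>2 / Re (h u u) > 0"
    by (simp only: Re_complex_of_real)
  then show ?thesis
    using assms(1) by (simp add: field_simps)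
qed

text \<open>The linear map between the two triples preserves \<open>h\<close>, which is determined
  by its values on a basis. Equal Gram determinants force its determinant to have modulus one; a
  unimodular factor \<open>c\<close> makes it one and does not change the images of the projective
  points.\<close>

lemma same_gram_imp_isometric:
  assumes "det (cols u v w) \<noteq> 0"
    and self: "h u' u' = h u u" "h v' v' = h v v" "h w' w' = h w w"
    and mixed: "h u' v' = h u v" "h v' w' = h v w" "h w' u' = h w u"
  obtains f c where "f \<in> SU21 h" "c \<noteq> 0" "f u = c *s u'" "f v = c *s v'" "f w = c *s w'"
proof -
  let ?U = "cols u v w" and ?V = "cols u' v' w'"
  have mixed': "h v' u' = h v u" "h w' v' = h w v" "h u' w' = h u w"
    using mixed by (metis h_cnj)+
  obtain k where k: "k > 0" "\<And>u v w. gram h u v w = - of_real (k * (cmod (det (cols u v w)))\<^sup>2)"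
    using gram_det by blast
  have "gram h u' v' w' = gram h u v w"
    by (simp add: gram_def self mixed mixed')
  then have "complex_of_real (k * (cmod (det ?V))\<^sup>2) = of_real (k * (cmod (det ?U))\<^sup>2)"
    unfolding k(2) by (rule neg_equal_iff_equal[THEN iffD1])
  then have "k * (cmod (det ?V))\<^sup>2 = k * (cmod (det ?U))\<^sup>2"
    by (simp only: of_real_eq_iff)
  then have norm_eq: "cmod (det ?V) = cmod (det ?U)"
    using k(1) by simp
  have "invertible ?U"
    using assms(1) by (simp add: invertible_det_nz)
  then obtain B where B: "?U ** B = mat 1" "B ** ?U = mat 1"
    unfolding invertible_def by blast
  define A where "A = ?V ** B"
  have AU: "A ** ?U = ?V"
    by (simp add: A_def B flip: matrix_mul_assoc)
  have "cols (A *v u) (A *v v) (A *v w) = cols u' v' w'"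
    using AU by (simp add: mult_cols)
  then have A_map: "A *v u = u'" "A *v v = v'" "A *v w = w'"
    by (simp_all add: cols_def transpose_def vec_eq_iff forall_3)
  have A_isom: "h (A *v x) (A *v y) = h x y" for x y
  proof -
    have "h (A *v (?U *v a)) (A *v (?U *v b)) = h (?U *v a) (?U *v b)" for a b
      by (simp only: matrix_vector_mul_assoc AU) (simp add: cols_mult h_simps self mixed mixed')
    from this[of "B *v x" "B *v y"] show ?thesis
      by (simp add: matrix_vector_mul_assoc B)
  qed
  have "det A * det ?U = det ?V"
    using arg_cong[OF AU, of det] by (simp add: det_mul)
  then have "cmod (det A) * cmod (det ?U) = cmod (det ?U)"
    using norm_eq by (metis norm_mult)
  then have "cmod (det A) = 1"
    using assms(1) by simp
  then obtain c where c: "cmod c = 1" "c ^ 3 * det A = 1"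
    using unimodular_cube_root by blast
  let ?C = "mat c ** A"
  have C: "?C *v x = c *s (A *v x)" for x
    by (simp add: vec_eq_iff matrix_vector_mult_def matrix_matrix_mult_def mat_def if_distrib
        if_distribR sum.delta' sum_distrib_left mult.assoc cong: if_cong)
  have "cnj c * c = 1"
    using c(1) by (simp add: mult.commute[of "cnj c"] flip: complex_norm_square)
  then have "h (?C *v x) (?C *v y) = h x y" for x y
    unfolding C h_scale_left h_scale_right A_isom by (simp flip: mult.assoc)
  moreover have "det (mat c :: complex ^ 3 ^ 3) = c ^ 3"
    by (simp add: det_3 mat_def power3_eq_cube)
  then have "det ?C = 1"
    using c(2) by (simp add: det_mul)
  ultimately have "(*v) ?C \<in> SU21 h"
    unfolding SU21_iff by blast
  moreover have "c \<noteq> 0"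
    using c(1) by auto
  ultimately show thesis
    using that[of "(*v) ?C" c] C A_map by simp
qed

end

section \<open>The trace of a product of three reflections\<close>

context hermitian_space
begin

text \<open>The trace of the rank-one operator sending \<open>x\<close> to
  \<open>h x p *s q\<close>, computed by expanding \<open>q\<close> in the standard basis.\<close>

lemma trace_rank_one: "(\<Sum>i\<in>UNIV. h (axis i 1) p * q $ i) = h q p"
proof -
  have "h q p = h (\<Sum>i\<in>UNIV. q $ i *s axis i 1) p"
    by (simp add: basis_expansion)
  then show ?thesis
    by (simp add: h_sum_left h_scale_left mult.commute)
qed

text \<open>Each reflection is a rank-one operator plus a scalar. The composition is thus a sum of
  rank-one operators, whose traces are products of Gram entries, and of a multiple of the identity,
  which yields the factor 3.\<close>

lemma trace_three_reflections:
  fixes a b c :: complex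
  assumes "h p p \<noteq> 0" "h q q \<noteq> 0" "h r r \<noteq> 0"
  defines "A \<equiv> a powi (-2) - a" and "B \<equiv> b powi (-2) - b" and "C \<equiv> c powi (-2) - c"
  shows "trace (matrix (reflection h c r \<circ> reflection h b q \<circ> reflection h a p)) =
    A * B * C * eta h p q r + A * B * c * tance h p q + A * b * C * tance h p r
    + a * B * C * tance h q r + A * b * c + a * B * c + a * b * C + 3 * a * b * c"
proof -
  define P Q R where "P = A / h p p" and "Q = B / h q q" and "R = C / h r r"
  let ?f = "reflection h c r \<circ> reflection h b q \<circ> reflection h a p"
  have reflection: "reflection h a p x = (P * h x p) *s p + a *s x"
    "reflection h b q x = (Q * h x q) *s q + b *s x"
    "reflection h c r x = (R * h x r) *s r + c *s x" for x
    by (simp_all add: reflection_def P_def Q_def R_def A_def B_def C_def)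
  have "?f x $ i =
      R * (Q * P * h p q * h q r + b * P * h p r) * (h x p * r $ i) + R * Q * a * h q r * (h x q * r $ i)
      + R * a * b * (h x r * r $ i) + c * Q * P * h p q * (h x p * q $ i) + c * Q * a * (h x q * q $ i)
      + c * b * P * (h x p * p $ i) + a * b * c * x $ i" for x i
    by (simp add: reflection h_simps) (simp add: algebra_simps)
  then have "trace (matrix ?f) =
      R * (Q * P * h p q * h q r + b * P * h p r) * h r p + R * Q * a * h q r * h r q
      + R * a * b * h r r + c * Q * P * h p q * h q p + c * Q * a * h q q
      + c * b * P * h p p + a * b * c * 3"
    by (simp only: trace_def matrix_def vec_lambda_beta sum.distrib trace_rank_one
        flip: sum_distrib_left) simp
  also have "\<dots> = A * B * C * eta h p q r + A * B * c * tance h p q + A * b * C * tance h p r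
    + a * B * C * tance h q r + A * b * c + a * B * c + a * b * C + 3 * a * b * c"
    using assms(1-3) by (simp add: P_def Q_def R_def eta_def tance_def field_simps)
  finally show ?thesis .
qed

end

text \<open>The Moebius map \<open>1 / (w - 1)\<close> takes the unit circle to a vertical line:
  since \<open>cnj w = 1 / w\<close>, its value and the conjugate add up to -1.\<close>

lemma Re_inverse_unimodular_minus_one:
  fixes w :: complex
  assumes "cmod w = 1" "w \<noteq> 1"
  shows "Re (1 / (w - 1)) = - 1 / 2"
proof -
  have "w * cnj w = 1"
    using assms(1) by (simp flip: complex_norm_square)
  then have cnj_w: "cnj w = 1 / w"
    by (auto simp: divide_simps mult.commute)
  have "w \<noteq> 0"
    using assms(1) by auto
  define z where "z = 1 / (w - 1)"
  have "z + cnj z = - 1"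
    using assms(2) \<open>w \<noteq> 0\<close>
    by (simp add: z_def cnj_w divide_simps) (simp add: algebra_simps)
  then have "Re z = - 1 / 2"
    by (simp add: complex_eq_iff)
  then show ?thesis
    by (simp only: z_def)
qed

text \<open>Factoring out \<alpha> leaves \<open>1 / \<alpha> ^ 3 - 1\<close>, and
  \<open>1 / \<alpha> ^ 3\<close> is a point of the unit circle other than 1.\<close>

lemma reflection_parameter:
  fixes \<alpha> :: complex
  assumes "cmod \<alpha> = 1" "\<alpha> ^ 3 \<noteq> 1"
  shows "\<alpha> powi (-2) - \<alpha> \<noteq> 0" "\<alpha> / (\<alpha> powi (-2) - \<alpha>) = Complex (- 1 / 2) (chi \<alpha>)"
proof -
  have "\<alpha> \<noteq> 0"
    using assms(1) by auto
  have factor: "\<alpha> powi (-2) - \<alpha> = \<alpha> * (1 / \<alpha> ^ 3 - 1)"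
    using \<open>\<alpha> \<noteq> 0\<close>
    by (simp add: power_int_minus field_simps power2_eq_square power3_eq_cube)
  then show "\<alpha> powi (-2) - \<alpha> \<noteq> 0"
    using \<open>\<alpha> \<noteq> 0\<close> assms(2) by simp
  have "Re (1 / (1 / \<alpha> ^ 3 - 1)) = - 1 / 2"
    by (rule Re_inverse_unimodular_minus_one) (use assms in \<open>auto simp: norm_divide norm_power\<close>)
  moreover have "\<alpha> / (\<alpha> powi (-2) - \<alpha>) = 1 / (1 / \<alpha> ^ 3 - 1)"
    using \<open>\<alpha> \<noteq> 0\<close> by (simp add: factor)
  ultimately show "\<alpha> / (\<alpha> powi (-2) - \<alpha>) = Complex (- 1 / 2) (chi \<alpha>)"
    by (simp add: chi_def complex_eq_iff)
qed

text \<open>Rewriting each \<open>\<alpha> powi (-2)\<close> in the numerator of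
  \<open>kappa\<close> as a difference plus \<alpha> produces the product of the three parameters
  three times, which matches the last term of the trace. Division by \<open>A * B * C\<close> leaves
  coefficients with real part -1/2 and imaginary part \<open>chi\<close>.\<close>

lemma trace_eq_iff_kappa:
  fixes \<alpha>1 \<alpha>2 \<alpha>3 :: complex and t1 t2 s :: real
  assumes "cmod \<alpha>1 = 1" "cmod \<alpha>2 = 1" "cmod \<alpha>3 = 1"
    and "\<alpha>1 ^ 3 \<noteq> 1" "\<alpha>2 ^ 3 \<noteq> 1" "\<alpha>3 ^ 3 \<noteq> 1"
  defines "A \<equiv> \<alpha>1 powi (-2) - \<alpha>1" and "B \<equiv> \<alpha>2 powi (-2) - \<alpha>2" and "C \<equiv> \<alpha>3 powi (-2) - \<alpha>3"
  shows "A * B * C * e + A * B * \<alpha>3 * of_real t1 + A * \<alpha>2 * C * of_real s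
      + \<alpha>1 * B * C * of_real t2 + A * \<alpha>2 * \<alpha>3 + \<alpha>1 * B * \<alpha>3 + \<alpha>1 * \<alpha>2 * C + 3 * \<alpha>1 * \<alpha>2 * \<alpha>3 = \<tau> \<longleftrightarrow>
    Re (kappa (\<alpha>1, \<alpha>2, \<alpha>3) \<tau>) = Re e - (t1 + t2 + s) / 2 \<and>
    Im (kappa (\<alpha>1, \<alpha>2, \<alpha>3) \<tau>) = Im e + chi \<alpha>3 * t1 + chi \<alpha>2 * s + chi \<alpha>1 * t2"
    (is "?trace = \<tau> \<longleftrightarrow> ?R")
proof -
  have nz: "A \<noteq> 0" "B \<noteq> 0" "C \<noteq> 0"
    unfolding A_def B_def C_def by (rule reflection_parameter(1); fact)+
  have quotients: "\<alpha>1 / A = Complex (- 1 / 2) (chi \<alpha>1)" "\<alpha>2 / B = Complex (- 1 / 2) (chi \<alpha>2)"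
    "\<alpha>3 / C = Complex (- 1 / 2) (chi \<alpha>3)"
    unfolding A_def B_def C_def by (rule reflection_parameter(2); fact)+
  have powi: "\<alpha>1 powi (-2) = A + \<alpha>1" "\<alpha>2 powi (-2) = B + \<alpha>2" "\<alpha>3 powi (-2) = C + \<alpha>3"
    by (simp_all add: A_def B_def C_def)
  have "kappa (\<alpha>1, \<alpha>2, \<alpha>3) \<tau> =
      (\<tau> - (A + \<alpha>1) * \<alpha>2 * \<alpha>3 - \<alpha>1 * (B + \<alpha>2) * \<alpha>3 - \<alpha>1 * \<alpha>2 * (C + \<alpha>3)) / (A * B * C)"
    by (simp add: kappa_def powi)
  then have "?trace = \<tau> \<longleftrightarrow> kappa (\<alpha>1, \<alpha>2, \<alpha>3) \<tau> =
      e + \<alpha>3 / C * of_real t1 + \<alpha>2 / B * of_real s + \<alpha>1 / A * of_real t2"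
    using nz by (simp add: divide_simps) (auto simp: algebra_simps)
  also have "\<dots> \<longleftrightarrow> ?R"
    unfolding quotients by (auto simp: complex_eq_iff field_simps)
  finally show ?thesis .
qed

text \<open>Here \<open>y = Im \<eta>\<close> and \<open>s = ta(p\<^sub>1, p\<^sub>3)\<close>: the equation of the surface is
  \<open>|\<eta>|\<^sup>2 = t\<^sub>1 t\<^sub>2 s\<close> after eliminating \<open>y\<close> and \<open>s\<close>.\<close>

lemma surface_iff:
  "(t1, t2, t) \<in> surface (\<alpha>1, \<alpha>2, \<alpha>3) (\<sigma>1, \<sigma>2, \<sigma>3) \<tau> \<longleftrightarrow>
    (\<exists>s y. t\<^sup>2 + y\<^sup>2 = t1 * t2 * s \<and>
      Re (kappa (\<alpha>1, \<alpha>2, \<alpha>3) \<tau>) = t - (t1 + t2 + s) / 2 \<and>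
      Im (kappa (\<alpha>1, \<alpha>2, \<alpha>3) \<tau>) = y + chi \<alpha>3 * t1 + chi \<alpha>2 * s + chi \<alpha>1 * t2) \<and>
    \<sigma>1 * \<sigma>2 * t1 > 0 \<and> \<sigma>1 * \<sigma>2 * t1 > \<sigma>1 * \<sigma>2 \<and>
    \<sigma>2 * \<sigma>3 * t2 > 0 \<and> \<sigma>2 * \<sigma>3 * t2 > \<sigma>2 * \<sigma>3 \<and>
    \<sigma>1 * \<sigma>2 * \<sigma>3 * (2 * Re (kappa (\<alpha>1, \<alpha>2, \<alpha>3) \<tau>) + 1) < 0"
    (is "_ \<longleftrightarrow> ?eq \<and> ?ineq")
proof -
  define k l x1 x2 x3 where "k = Re (kappa (\<alpha>1, \<alpha>2, \<alpha>3) \<tau>)" and "l = Im (kappa (\<alpha>1, \<alpha>2, \<alpha>3) \<tau>)"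
    and "x1 = chi \<alpha>1" and "x2 = chi \<alpha>2" and "x3 = chi \<alpha>3"
  note defs = k_def[symmetric] l_def[symmetric] x1_def[symmetric] x2_def[symmetric] x3_def[symmetric]
  \<comment> \<open>The two equations for \<open>kappa\<close> are linear and triangular in the
    unknowns: the real part gives \<open>s\<close>, then the imaginary part gives \<open>y\<close>.
    The existential quantifiers therefore have only these witnesses.\<close>
  define s y where "s = 2 * t - t1 - t2 - 2 * k" and "y = l - x3 * t1 - x2 * s - x1 * t2"
  have "?eq \<longleftrightarrow> t\<^sup>2 + y\<^sup>2 = t1 * t2 * s"
  proof
    assume ?eq
    then obtain s' y' where *: "t\<^sup>2 + y'\<^sup>2 = t1 * t2 * s'" "k = t - (t1 + t2 + s') / 2"
      "l = y' + x3 * t1 + x2 * s' + x1 * t2"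
      unfolding defs by blast
    have "s' = s"
      using *(2) by (simp add: s_def field_simps)
    moreover from this have "y' = y"
      using *(3) by (simp add: y_def)
    ultimately show "t\<^sup>2 + y\<^sup>2 = t1 * t2 * s"
      using *(1) by simp
  next
    assume "t\<^sup>2 + y\<^sup>2 = t1 * t2 * s"
    then show ?eq
      unfolding defs by (intro exI[of _ s] exI[of _ y]) (simp add: s_def y_def field_simps)
  qed
  also have "\<dots> \<longleftrightarrow> t1\<^sup>2 * t2 + t1 * t2\<^sup>2 - 2 * t1 * t2 * t + (x3 - x2)\<^sup>2 * t1\<^sup>2 + (x1 - x2)\<^sup>2 * t2\<^sup>2
      + (1 + 4 * x2\<^sup>2) * t\<^sup>2 + (2 * ((x1 - x2) * (x3 - x2) + k)) * t1 * t2
      + (4 * x2 * (x3 - x2)) * t1 * t + (4 * x2 * (x1 - x2)) * t2 * t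
      + (2 * (x2 - x3) * (2 * x2 * k + l)) * t1 + (2 * (x2 - x1) * (2 * x2 * k + l)) * t2
      + (- 4 * x2 * (2 * x2 * k + l)) * t + (2 * x2 * k + l)\<^sup>2 = 0" (is "_ \<longleftrightarrow> ?poly = 0")
  proof -
    have "?poly = t\<^sup>2 + y\<^sup>2 - t1 * t2 * s"
      unfolding y_def s_def by (simp add: power2_eq_square) (simp add: algebra_simps)
    then show ?thesis
      by simp
  qed
  finally show ?thesis
    by (simp add: surface_def Let_def k_def l_def x1_def x2_def x3_def)
qed

section \<open>Normalized Gram matrices\<close>

text \<open>Two of the mixed Gram entries are made real, so that the phase of \<open>eta\<close>
  sits, up to sign, in the remaining entry \<open>z\<close>.\<close>

definition normal_triple :: "form \<Rightarrow> real \<Rightarrow> real \<Rightarrow> real \<Rightarrow> real \<Rightarrow> real \<Rightarrow> complex \<Rightarrow>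
    complex ^ 3 \<Rightarrow> complex ^ 3 \<Rightarrow> complex ^ 3 \<Rightarrow> bool" where
  "normal_triple h \<sigma>1 \<sigma>2 \<sigma>3 r q z u v w \<longleftrightarrow>
     h u u = of_real \<sigma>1 \<and> h v v = of_real \<sigma>2 \<and> h w w = of_real \<sigma>3 \<and>
     h u v = of_real r \<and> h v w = of_real q \<and> h w u = z"

context hermitian_space
begin

lemma normal_triple_mixed:
  assumes "normal_triple h \<sigma>1 \<sigma>2 \<sigma>3 r q z u v w"
  shows "h v u = of_real r" "h w v = of_real q" "h u w = cnj z"
  using assms unfolding normal_triple_def by (metis h_cnj complex_cnj_complex_of_real)+

lemma gram_normal_triple:
  assumes "normal_triple h \<sigma>1 \<sigma>2 \<sigma>3 r q z u v w"
  shows "Re (gram h u v w) =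
    \<sigma>1 * \<sigma>2 * \<sigma>3 + 2 * r * q * Re z - \<sigma>1 * q\<^sup>2 - \<sigma>2 * (cmod z)\<^sup>2 - \<sigma>3 * r\<^sup>2"
proof -
  have "h u w * h w u = of_real ((cmod z)\<^sup>2)"
    using h_mult_swap[of w u] assms by (simp add: normal_triple_def mult.commute)
  then show ?thesis
    using assms normal_triple_mixed[OF assms]
    by (simp add: gram_def normal_triple_def power2_eq_square algebra_simps)
qed

lemma exists_normalized_representative:
  assumes "p \<in> proj_plane" "point_sign h (rep p) \<noteq> 0"
  obtains v where "v \<in> p" "v \<noteq> 0" "h v v = of_real (point_sign h (rep p))"
proof -
  define N where "N = Re (h (rep p) (rep p))"
  define v where "v = complex_of_real (1 / sqrt \<bar>N\<bar>) *s rep p"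
  have "N \<noteq> 0"
    using assms(2) by (auto simp: N_def point_sign_def)
  have "p = vec.span {rep p}"
    using proj_plane_eq_span rep_props assms(1) by blast
  then have "v \<in> p"
    unfolding v_def by (metis vec.span_base vec.span_scale singletonI)
  moreover have "v \<noteq> 0"
    using \<open>N \<noteq> 0\<close> rep_props(2)[OF assms(1)] by (simp add: v_def)
  moreover have "h v v = of_real (1 / sqrt \<bar>N\<bar> * (1 / sqrt \<bar>N\<bar>) * N)"
    unfolding v_def h_scale_left h_scale_right
    by (subst h_self_real)
      (simp only: N_def[symmetric] of_real_mult complex_cnj_complex_of_real mult_ac)
  moreover have "1 / sqrt \<bar>N\<bar> * (1 / sqrt \<bar>N\<bar>) * N = sgn N"
    by (simp add: sgn_real_def)
  ultimately have "h v v = of_real (point_sign h (rep p))"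
    by (simp only: point_sign_def N_def[symmetric])
  then show thesis
    using that \<open>v \<in> p\<close> \<open>v \<noteq> 0\<close> by blast
qed

text \<open>A scalar of modulus one rotates \<open>h v w\<close> onto the positive axis and
  preserves \<open>h v v\<close>.\<close>

lemma exists_phase:
  assumes "h v w \<noteq> 0"
  obtains c where "c \<noteq> 0" "h (c *s v) w = of_real (cmod (h v w))" "h (c *s v) (c *s v) = h v v"
proof -
  define c where "c = cnj (h v w) / of_real (cmod (h v w))"
  have "cmod c = 1"
    using assms by (simp add: c_def norm_divide)
  then have "cnj c * c = 1"
    by (simp add: mult.commute[of "cnj c"] flip: complex_norm_square)
  then have "h (c *s v) (c *s v) = h v v"
    by (simp add: h_scale_left h_scale_right flip: mult.assoc)
  moreover have "h (c *s v) w = of_real (cmod (h v w))"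
    using assms complex_norm_square[of "h v w"]
    by (simp add: c_def h_scale_left power2_eq_square divide_simps mult.commute)
  moreover have "c \<noteq> 0"
    using \<open>cmod c = 1\<close> by auto
  ultimately show thesis
    using that by blast
qed

text \<open>Because \<open>p2\<close> is orthogonal to neither neighbour, the phases of
  \<open>u\<close> and \<open>w\<close> can be adjusted independently against a fixed
  \<open>v\<close>.\<close>

lemma strongly_regular_imp_normal_triple:
  assumes "strongly_regular h (\<alpha>1, \<alpha>2, \<alpha>3) (\<sigma>1, \<sigma>2, \<sigma>3) \<tau> (p1, p2, p3)"
  obtains u v w r q z where "normal_triple h \<sigma>1 \<sigma>2 \<sigma>3 r q z u v w" "r > 0" "q > 0"
    "det (cols u v w) \<noteq> 0" "p1 = vec.span {u}" "p2 = vec.span {v}" "p3 = vec.span {w}"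
proof -
  have p: "p1 \<in> proj_plane" "p2 \<in> proj_plane" "p3 \<in> proj_plane" "p1 \<noteq> p2"
    and sign: "point_sign h (rep p1) = \<sigma>1" "point_sign h (rep p2) = \<sigma>2" "point_sign h (rep p3) = \<sigma>3"
    "point_sign h (rep p1) \<noteq> 0" "point_sign h (rep p2) \<noteq> 0" "point_sign h (rep p3) \<noteq> 0"
    and orth: "h (rep p2) (rep p1) \<noteq> 0" "h (rep p2) (rep p3) \<noteq> 0"
    and line: "\<not> on_common_line p1 p2 p3"
    using assms by (auto simp: strongly_regular_def)
  obtain u' where u': "u' \<in> p1" "u' \<noteq> 0" "h u' u' = of_real \<sigma>1"
    using exists_normalized_representative[OF p(1) sign(4)] sign(1) by metis
  obtain v where v: "v \<in> p2" "v \<noteq> 0" "h v v = of_real \<sigma>2"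
    using exists_normalized_representative[OF p(2) sign(5)] sign(2) by metis
  obtain w' where w': "w' \<in> p3" "w' \<noteq> 0" "h w' w' = of_real \<sigma>3"
    using exists_normalized_representative[OF p(3) sign(6)] sign(3) by metis
  have "h v u' \<noteq> 0" "h v w' \<noteq> 0"
    using orth orthogonal_rep[OF hermitian] p u' v w' by blast+
  then have nz: "h u' v \<noteq> 0" "h w' v \<noteq> 0"
    using h_cnj by (metis complex_cnj_zero)+
  obtain a where a: "a \<noteq> 0" "h (a *s u') v = of_real (cmod (h u' v))" "h (a *s u') (a *s u') = h u' u'"
    using exists_phase[OF nz(1)] by blast
  obtain c where c: "c \<noteq> 0" "h (c *s w') v = of_real (cmod (h w' v))" "h (c *s w') (c *s w') = h w' w'"
    using exists_phase[OF nz(2)] by blast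
  define u w where "u = a *s u'" and "w = c *s w'"
  have "h v w = of_real (cmod (h w' v))"
    using c(2) h_cnj[of w v] by (simp add: w_def)
  then have normal: "normal_triple h \<sigma>1 \<sigma>2 \<sigma>3 (cmod (h u' v)) (cmod (h w' v)) (h w u) u v w"
    using a c u' v w' by (simp add: normal_triple_def u_def w_def)
  have spans: "p1 = vec.span {u}" "p2 = vec.span {v}" "p3 = vec.span {w}"
    unfolding u_def w_def using a(1) c(1) u' v w' p proj_plane_eq_span
    by (simp_all add: span_scale_singleton)
  have "u \<noteq> 0"
    using a(1) u'(2) by (simp add: u_def)
  then have "det (cols u v w) \<noteq> 0"
    using line p(4) v(2) unfolding spans by (simp add: on_common_line_iff)
  then show thesis
    using that[OF normal] nz spans by simp
qed

text \<open>A sign is its own inverse, so the denominators turn into factors.\<close>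

lemma normal_triple_invariants:
  assumes "normal_triple h \<sigma>1 \<sigma>2 \<sigma>3 r q z u v w" "\<sigma>1 \<in> {-1, 1}" "\<sigma>2 \<in> {-1, 1}" "\<sigma>3 \<in> {-1, 1}"
  shows "tance h u v = of_real (\<sigma>1 * \<sigma>2 * r\<^sup>2)" "tance h v w = of_real (\<sigma>2 * \<sigma>3 * q\<^sup>2)"
    "tance h u w = of_real (\<sigma>1 * \<sigma>3 * (cmod z)\<^sup>2)" "eta h u v w = of_real (\<sigma>1 * \<sigma>2 * \<sigma>3 * r * q) * z"
proof -
  note mixed = normal_triple_mixed[OF assms(1)]
  have "h u w * h w u = of_real ((cmod z)\<^sup>2)"
    using h_mult_swap[of w u] assms by (simp add: normal_triple_def mult.commute)
  then show "tance h u v = of_real (\<sigma>1 * \<sigma>2 * r\<^sup>2)" "tance h v w = of_real (\<sigma>2 * \<sigma>3 * q\<^sup>2)"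
    "tance h u w = of_real (\<sigma>1 * \<sigma>3 * (cmod z)\<^sup>2)" "eta h u v w = of_real (\<sigma>1 * \<sigma>2 * \<sigma>3 * r * q) * z"
    using assms mixed by (auto simp: tance_def eta_def normal_triple_def power2_eq_square)
qed

lemma parameters_normal_triple:
  assumes "normal_triple h \<sigma>1 \<sigma>2 \<sigma>3 r q z u v w" "\<sigma>1 \<in> {-1, 1}" "\<sigma>2 \<in> {-1, 1}" "\<sigma>3 \<in> {-1, 1}"
  shows "parameters h (vec.span {u}, vec.span {v}, vec.span {w}) =
    (\<sigma>1 * \<sigma>2 * r\<^sup>2, \<sigma>2 * \<sigma>3 * q\<^sup>2, \<sigma>1 * \<sigma>2 * \<sigma>3 * r * q * Re z)"
proof -
  have nz: "u \<noteq> 0" "v \<noteq> 0" "w \<noteq> 0"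
    using assms by (auto simp: normal_triple_def h_zero_left)
  have span: "vec.span {x} \<in> proj_plane \<and> x \<in> vec.span {x}" if "x \<noteq> 0" for x
    using that by (simp add: span_in_proj_plane vec.span_base)
  have "tance h (rep (vec.span {u})) (rep (vec.span {v})) = tance h u v"
    "tance h (rep (vec.span {v})) (rep (vec.span {w})) = tance h v w"
    "eta h (rep (vec.span {u})) (rep (vec.span {v})) (rep (vec.span {w})) = eta h u v w"
    using nz span by (simp_all add: tance_rep[OF hermitian] eta_rep[OF hermitian])
  then show ?thesis
    by (simp add: parameters_def normal_triple_invariants[OF assms])
qed

text \<open>Normalization and independence already give every clause of strong regularity except the
  trace condition, which splits into two real equations.\<close>

lemma strongly_regular_normal_triple_iff:
  assumes "normal_triple h \<sigma>1 \<sigma>2 \<sigma>3 r q z u v w" "\<sigma>1 \<in> {-1, 1}" "\<sigma>2 \<in> {-1, 1}" "\<sigma>3 \<in> {-1, 1}"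
    and "r > 0" "q > 0" "det (cols u v w) \<noteq> 0"
    and "cmod \<alpha>1 = 1" "cmod \<alpha>2 = 1" "cmod \<alpha>3 = 1"
    and "\<alpha>1 ^ 3 \<noteq> 1" "\<alpha>2 ^ 3 \<noteq> 1" "\<alpha>3 ^ 3 \<noteq> 1"
  defines "t1 \<equiv> \<sigma>1 * \<sigma>2 * r\<^sup>2" and "t2 \<equiv> \<sigma>2 * \<sigma>3 * q\<^sup>2" and "s \<equiv> \<sigma>1 * \<sigma>3 * (cmod z)\<^sup>2"
    and "e \<equiv> of_real (\<sigma>1 * \<sigma>2 * \<sigma>3 * r * q) * z"
  shows "strongly_regular h (\<alpha>1, \<alpha>2, \<alpha>3) (\<sigma>1, \<sigma>2, \<sigma>3) \<tau> (vec.span {u}, vec.span {v}, vec.span {w}) \<longleftrightarrow>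
    Re (kappa (\<alpha>1, \<alpha>2, \<alpha>3) \<tau>) = Re e - (t1 + t2 + s) / 2 \<and>
    Im (kappa (\<alpha>1, \<alpha>2, \<alpha>3) \<tau>) = Im e + chi \<alpha>3 * t1 + chi \<alpha>2 * s + chi \<alpha>1 * t2"
    (is "_ \<longleftrightarrow> ?R")
proof -
  have nz: "u \<noteq> 0" "v \<noteq> 0" "w \<noteq> 0" "h u u \<noteq> 0" "h v v \<noteq> 0" "h w w \<noteq> 0"
    using assms(1-4) by (auto simp: normal_triple_def h_zero_left)
  note mem = nz(1-3)[THEN span_in_proj_plane] vec.span_base[OF singletonI, of u]
    vec.span_base[OF singletonI, of v] vec.span_base[OF singletonI, of w]
  have distinct: "vec.span {u} \<noteq> vec.span {v}" "vec.span {v} \<noteq> vec.span {w}" "vec.span {u} \<noteq> vec.span {w}"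
    using det_cols_nz_imp_notin_span[OF assms(7)] mem by auto
  have line: "\<not> on_common_line (vec.span {u}) (vec.span {v}) (vec.span {w})"
    using on_common_line_iff nz distinct assms(7) by blast
  have sign: "point_sign h (rep (vec.span {u})) = \<sigma>1" "point_sign h (rep (vec.span {v})) = \<sigma>2"
    "point_sign h (rep (vec.span {w})) = \<sigma>3"
    using point_sign_rep[OF hermitian] mem nz assms(1-4)
    by (auto simp: point_sign_def normal_triple_def)
  have "h v u \<noteq> 0" "h v w \<noteq> 0"
    using assms(1,5,6) normal_triple_mixed[OF assms(1)] by (simp_all add: normal_triple_def)
  then have orth: "h (rep (vec.span {v})) (rep (vec.span {u})) \<noteq> 0"
    "h (rep (vec.span {v})) (rep (vec.span {w})) \<noteq> 0"
    using orthogonal_rep[OF hermitian] mem nz by blast+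
  have "reflection h \<alpha>3 (rep (vec.span {w})) \<circ> reflection h \<alpha>2 (rep (vec.span {v})) \<circ>
      reflection h \<alpha>1 (rep (vec.span {u})) =
      reflection h \<alpha>3 w \<circ> reflection h \<alpha>2 v \<circ> reflection h \<alpha>1 u"
    using reflection_rep[OF hermitian] mem nz by simp
  then have "strongly_regular h (\<alpha>1, \<alpha>2, \<alpha>3) (\<sigma>1, \<sigma>2, \<sigma>3) \<tau> (vec.span {u}, vec.span {v}, vec.span {w}) \<longleftrightarrow>
      trace (matrix (reflection h \<alpha>3 w \<circ> reflection h \<alpha>2 v \<circ> reflection h \<alpha>1 u)) = \<tau>"
    using mem sign orth distinct line assms(2-4) by (auto simp: strongly_regular_def)
  also have "\<dots> \<longleftrightarrow> ?R"
    unfolding trace_three_reflections[OF nz(4-6)] normal_triple_invariants[OF assms(1-4)]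
      t1_def[symmetric] t2_def[symmetric] s_def[symmetric] e_def[symmetric]
    by (rule trace_eq_iff_kappa; fact)
  finally show ?thesis .
qed

end

section \<open>Realizing a prescribed Gram matrix\<close>

context signature_space
begin

text \<open>A reordering of an orthonormal frame: \<open>e\<close> and \<open>e'\<close> span a
  plane of signature \<open>+-\<close> whichever sign \<open>e\<close> has, and a positive vector is
  left over.\<close>

lemma orthogonal_frame_from_sign:
  assumes "\<sigma> \<in> {-1, 1 :: real}"
  obtains e e' e'' where "h e e = of_real \<sigma>" "h e' e' = - of_real \<sigma>" "h e'' e'' = 1"
    "h e e' = 0" "h e' e = 0" "h e e'' = 0" "h e'' e = 0" "h e' e'' = 0" "h e'' e' = 0"
proof -
  obtain e1 e2 e3 where e: "h e1 e1 = 1" "h e2 e2 = 1" "h e3 e3 = - 1" "h e1 e2 = 0" "h e1 e3 = 0" "h e2 e3 = 0"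
    using signature unfolding signature_ppm_def by blast
  moreover from this have "h e2 e1 = 0" "h e3 e1 = 0" "h e3 e2 = 0"
    using h_cnj by (metis complex_cnj_zero)+
  ultimately show thesis
    using assms that[of e1 e3 e2] that[of e3 e1 e2] by auto
qed

text \<open>The first two vectors span a plane of signature \<open>+-\<close>; the sign of the Gram determinant then
  says that the component of the third one orthogonal to that plane must be positive.\<close>

lemma exists_normal_triple:
  assumes "\<sigma>1 \<in> {-1, 1}" "\<sigma>1 * \<sigma>2 < r\<^sup>2"
    and "\<sigma>1 * \<sigma>2 * \<sigma>3 + 2 * r * q * Re z - \<sigma>1 * q\<^sup>2 - \<sigma>2 * (cmod z)\<^sup>2 - \<sigma>3 * r\<^sup>2 < 0"
  obtains u v w where "normal_triple h \<sigma>1 \<sigma>2 \<sigma>3 r q z u v w"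
proof -
  obtain e e' e'' where e: "h e e = of_real \<sigma>1" "h e' e' = - of_real \<sigma>1" "h e'' e'' = 1"
    "h e e' = 0" "h e' e = 0" "h e e'' = 0" "h e'' e = 0" "h e' e'' = 0" "h e'' e' = 0"
    using orthogonal_frame_from_sign[OF assms(1)] by blast
  \<comment> \<open>Gram-Schmidt run backwards: \<open>h v v\<close> dictates \<open>b\<close>,
    \<open>h v w\<close> dictates \<open>d\<close>, and \<open>h w w\<close> dictates
    \<open>f\<close>. The target Gram determinant \<open>D\<close> equals minus the square of
    \<open>b * f\<close>, whence the formula for \<open>f\<close>.\<close>
  define D where "D = \<sigma>1 * \<sigma>2 * \<sigma>3 + 2 * r * q * Re z - \<sigma>1 * q\<^sup>2 - \<sigma>2 * (cmod z)\<^sup>2 - \<sigma>3 * r\<^sup>2"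
  define b where "b = sqrt (r\<^sup>2 - \<sigma>1 * \<sigma>2)"
  define f where "f = sqrt (- D) / b"
  define d where "d = (of_real r * z - of_real (\<sigma>1 * q)) / of_real b"
  have b: "b > 0" "b\<^sup>2 = r\<^sup>2 - \<sigma>1 * \<sigma>2"
    using assms(2) by (simp_all add: b_def)
  have f: "f\<^sup>2 = - D / b\<^sup>2"
    using assms(3) by (simp add: f_def D_def power_divide)
  have \<sigma>1: "\<sigma>1 * \<sigma>1 = 1"
    using assms(1) by auto
  define u v w where "u = e" and "v = of_real (\<sigma>1 * r) *s e + of_real b *s e'"
    and "w = (of_real \<sigma>1 * z) *s e + d *s e' + of_real f *s e''"
  have "h v v = of_real (\<sigma>1 * \<sigma>1 * \<sigma>1 * r\<^sup>2 - \<sigma>1 * b\<^sup>2)"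
    by (simp add: v_def h_simps e power2_eq_square algebra_simps)
  also have "\<sigma>1 * \<sigma>1 * \<sigma>1 * r\<^sup>2 - \<sigma>1 * b\<^sup>2 = \<sigma>2"
    using \<sigma>1 b(2) by (simp add: right_diff_distrib flip: mult.assoc)
  finally have "h v v = of_real \<sigma>2" .
  moreover have "h u v = of_real r"
    using \<sigma>1 by (simp add: u_def v_def h_simps e flip: of_real_mult mult.assoc)
  moreover have "h w u = z"
    using \<sigma>1 by (simp add: u_def w_def h_simps e mult.commute[of _ z] mult.assoc flip: of_real_mult)
  moreover have "h v w = of_real q"
  proof -
    have "of_real b * cnj d = of_real r * cnj z - of_real (\<sigma>1 * q)"
      using b(1) by (simp add: d_def)
    moreover have "h v w = of_real \<sigma>1 * (of_real (\<sigma>1 * \<sigma>1) * of_real r * cnj z - of_real b * cnj d)"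
      by (simp add: v_def w_def h_simps e algebra_simps)
    ultimately have "h v w = of_real (\<sigma>1 * (\<sigma>1 * q))"
      unfolding \<sigma>1 by simp
    moreover have "\<sigma>1 * (\<sigma>1 * q) = q"
      using \<sigma>1 by (simp flip: mult.assoc)
    ultimately show ?thesis
      by (simp only:)
  qed
  moreover have "h w w = of_real \<sigma>3"
  proof -
    have "h w w = of_real \<sigma>1 * of_real (\<sigma>1 * \<sigma>1) * (z * cnj z) - of_real \<sigma>1 * (d * cnj d) + of_real (f\<^sup>2)"
      by (simp add: w_def h_simps e power2_eq_square algebra_simps)
    also have "\<dots> = of_real (\<sigma>1 * (cmod z)\<^sup>2 - \<sigma>1 * (cmod d)\<^sup>2 + f\<^sup>2)"
      unfolding complex_norm_square[symmetric] \<sigma>1 by simp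
    also have "\<sigma>1 * (cmod z)\<^sup>2 - \<sigma>1 * (cmod d)\<^sup>2 + f\<^sup>2 = \<sigma>3"
    proof -
      have "(cmod (of_real r * z - of_real (\<sigma>1 * q)))\<^sup>2 =
          r\<^sup>2 * (cmod z)\<^sup>2 - 2 * r * q * \<sigma>1 * Re z + (\<sigma>1 * \<sigma>1) * q\<^sup>2"
        unfolding cmod_power2 by (simp add: power2_eq_square algebra_simps)
      then have d: "(cmod d)\<^sup>2 = (r\<^sup>2 * (cmod z)\<^sup>2 - 2 * r * q * \<sigma>1 * Re z + q\<^sup>2) / b\<^sup>2"
        using b(1) unfolding \<sigma>1 d_def norm_divide power_divide by simp
      have "\<sigma>1 * (cmod z)\<^sup>2 - \<sigma>1 * (cmod d)\<^sup>2 + f\<^sup>2 =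
          \<sigma>1 * (cmod z)\<^sup>2 - (\<sigma>1 * r\<^sup>2 * (cmod z)\<^sup>2 - 2 * r * q * (\<sigma>1 * \<sigma>1) * Re z + \<sigma>1 * q\<^sup>2 + D) / b\<^sup>2"
        unfolding f d by (simp add: diff_divide_distrib add_divide_distrib algebra_simps)
      \<comment> \<open>After inserting \<open>D\<close>, the terms with \<open>q\<close> cancel and
        the numerator contains the factor \<open>r\<^sup>2 - \<sigma>1 * \<sigma>2\<close>, that is,
        \<open>b\<^sup>2\<close>.\<close>
      also have "\<dots> = \<sigma>1 * (cmod z)\<^sup>2 - (\<sigma>1 * (cmod z)\<^sup>2 - \<sigma>3) * b\<^sup>2 / b\<^sup>2"
      proof -
        have "(\<sigma>1 * (cmod z)\<^sup>2 - \<sigma>3) * b\<^sup>2 =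
            \<sigma>1 * r\<^sup>2 * (cmod z)\<^sup>2 - (\<sigma>1 * \<sigma>1) * \<sigma>2 * (cmod z)\<^sup>2 - \<sigma>3 * r\<^sup>2 + \<sigma>1 * \<sigma>2 * \<sigma>3"
          by (simp add: b(2) algebra_simps)
        then show ?thesis
          by (simp add: \<sigma>1 D_def)
      qed
      finally show ?thesis
        using b(1) by simp
    qed
    finally show ?thesis .
  qed
  ultimately show thesis
    using that[of u v w] e(1) by (simp add: normal_triple_def u_def)
qed

end

section \<open>The parameterization\<close>

locale admissible_parameters = signature_space +
  fixes \<alpha>1 \<alpha>2 \<alpha>3 :: complex and \<sigma>1 \<sigma>2 \<sigma>3 :: real and \<tau> :: complex
  assumes unimodular: "cmod \<alpha>1 = 1" "cmod \<alpha>2 = 1" "cmod \<alpha>3 = 1"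
    and not_cube_root: "\<alpha>1 ^ 3 \<noteq> 1" "\<alpha>2 ^ 3 \<noteq> 1" "\<alpha>3 ^ 3 \<noteq> 1"
    and signs: "\<sigma>1 \<in> {-1, 1}" "\<sigma>2 \<in> {-1, 1}" "\<sigma>3 \<in> {-1, 1}"
    and one_positive: "\<not> (\<sigma>1 > 0 \<and> \<sigma>2 > 0)" "\<not> (\<sigma>2 > 0 \<and> \<sigma>3 > 0)"
begin

abbreviation "regular \<equiv> strongly_regular h (\<alpha>1, \<alpha>2, \<alpha>3) (\<sigma>1, \<sigma>2, \<sigma>3) \<tau>"

abbreviation "normal \<equiv> normal_triple h \<sigma>1 \<sigma>2 \<sigma>3"

lemma regular_imp_normal:
  assumes "regular P"
  shows "\<exists>u v w r q z. normal r q z u v w \<and> r > 0 \<and> q > 0 \<and> det (cols u v w) \<noteq> 0 \<and>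
    P = (vec.span {u}, vec.span {v}, vec.span {w})"
proof -
  obtain p1 p2 p3 where P: "P = (p1, p2, p3)"
    by (cases P)
  show ?thesis
    by (rule strongly_regular_imp_normal_triple[OF assms[unfolded P]]) (use P in blast)
qed

lemmas regular_normal_iff =
  strongly_regular_normal_triple_iff[OF _ signs _ _ _ unimodular not_cube_root]

text \<open>For two negative points this is the reversed Cauchy-Schwarz inequality; for opposite
  signs the left side is -1, below any square. It yields the lower bounds on the tances in the
  surface.\<close>

lemma sign_product_less_mixed:
  assumes "h u u = of_real s" "h v v = of_real s'" "s \<in> {-1, 1}" "s' \<in> {-1, 1}"
    and "\<not> (s > 0 \<and> s' > 0)" "h u v \<noteq> 0" "v \<notin> vec.span {u}"
  shows "s * s' < (cmod (h u v))\<^sup>2"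
proof (cases "s = -1 \<and> s' = -1")
  case True
  then show ?thesis
    using negative_points_cauchy_schwarz[of u v] assms by simp
next
  case False
  then have "s * s' = -1"
    using assms(3-5) by auto
  then show ?thesis
    using assms(6) by (smt (verit) zero_le_power2)
qed

lemma norm_eta:
  "(cmod (of_real (\<sigma>1 * \<sigma>2 * \<sigma>3 * r * q) * z))\<^sup>2 =
    (\<sigma>1 * \<sigma>2 * r\<^sup>2) * (\<sigma>2 * \<sigma>3 * q\<^sup>2) * (\<sigma>1 * \<sigma>3 * (cmod z)\<^sup>2)"
  using signs by (auto simp: norm_mult power_mult_distrib)

text \<open>Divided by the product of the signs, the Gram determinant is 1 plus twice the real part
  of \<open>eta\<close> minus the three tances; the real part of the trace equation identifies this
  with \<open>2 * Re \<kappa> + 1\<close>.\<close>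

lemma gram_normal_kappa:
  assumes "normal r q z u v w"
    and "Re (kappa (\<alpha>1, \<alpha>2, \<alpha>3) \<tau>) = Re (of_real (\<sigma>1 * \<sigma>2 * \<sigma>3 * r * q) * z)
      - (\<sigma>1 * \<sigma>2 * r\<^sup>2 + \<sigma>2 * \<sigma>3 * q\<^sup>2 + \<sigma>1 * \<sigma>3 * (cmod z)\<^sup>2) / 2"
  shows "Re (gram h u v w) = \<sigma>1 * \<sigma>2 * \<sigma>3 * (2 * Re (kappa (\<alpha>1, \<alpha>2, \<alpha>3) \<tau>) + 1)"
  unfolding gram_normal_triple[OF assms(1)] assms(2) using signs
  by (auto simp: field_simps)

lemma parameters_in_surface:
  assumes "regular P"
  shows "parameters h P \<in> surface (\<alpha>1, \<alpha>2, \<alpha>3) (\<sigma>1, \<sigma>2, \<sigma>3) \<tau>"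
proof -
  obtain u v w r q z where N: "normal r q z u v w" "r > 0" "q > 0" "det (cols u v w) \<noteq> 0"
    and P: "P = (vec.span {u}, vec.span {v}, vec.span {w})"
    using regular_imp_normal[OF assms] by blast
  let ?\<eta> = "of_real (\<sigma>1 * \<sigma>2 * \<sigma>3 * r * q) * z"
  let ?s = "\<sigma>1 * \<sigma>3 * (cmod z)\<^sup>2"
  note kappa = assms[unfolded P regular_normal_iff[OF N]]
  have "(Re ?\<eta>)\<^sup>2 + (Im ?\<eta>)\<^sup>2 = (\<sigma>1 * \<sigma>2 * r\<^sup>2) * (\<sigma>2 * \<sigma>3 * q\<^sup>2) * ?s"
    using norm_eta[of r q z] by (simp only: cmod_power2)
  moreover have "\<sigma>1 * \<sigma>2 < r\<^sup>2" "\<sigma>2 * \<sigma>3 < q\<^sup>2"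
    using sign_product_less_mixed[of u \<sigma>1 v \<sigma>2] sign_product_less_mixed[of v \<sigma>2 w \<sigma>3]
      N signs one_positive det_cols_nz_imp_notin_span[OF N(4)] by (simp_all add: normal_triple_def)
  moreover have "\<sigma>1 * \<sigma>2 * (\<sigma>1 * \<sigma>2 * r\<^sup>2) = r\<^sup>2" "\<sigma>2 * \<sigma>3 * (\<sigma>2 * \<sigma>3 * q\<^sup>2) = q\<^sup>2"
    using signs by auto
  moreover have "\<sigma>1 * \<sigma>2 * \<sigma>3 * (2 * Re (kappa (\<alpha>1, \<alpha>2, \<alpha>3) \<tau>) + 1) < 0"
    using gram_normal_kappa[OF N(1)] kappa Re_gram_neg_iff[of u v w] N(4) by simp
  moreover have "parameters h P = (\<sigma>1 * \<sigma>2 * r\<^sup>2, \<sigma>2 * \<sigma>3 * q\<^sup>2, Re ?\<eta>)"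
    unfolding P parameters_normal_triple[OF N(1) signs] by simp
  ultimately show ?thesis
    using kappa N(2,3) unfolding surface_iff by (auto simp only: surface_iff zero_less_power)
qed

text \<open>The coordinates and the trace equation recover the whole normalized Gram matrix:
  positivity gives \<open>r\<close> and \<open>q\<close>, then \<open>Re z\<close> follows, and the
  two real equations give \<open>cmod z\<close> and \<open>Im z\<close>.\<close>

lemma orbit_eq_of_parameters_eq:
  assumes "regular P" "regular P'" "parameters h P = parameters h P'"
  shows "SU21_orbit h P = SU21_orbit h P'"
proof -
  obtain u v w r q z where N: "normal r q z u v w" "r > 0" "q > 0" "det (cols u v w) \<noteq> 0"
    and P: "P = (vec.span {u}, vec.span {v}, vec.span {w})"
    using regular_imp_normal[OF assms(1)] by blast
  obtain u' v' w' r' q' z' where N': "normal r' q' z' u' v' w'" "r' > 0" "q' > 0" "det (cols u' v' w') \<noteq> 0"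
    and P': "P' = (vec.span {u'}, vec.span {v'}, vec.span {w'})"
    using regular_imp_normal[OF assms(2)] by blast
  note kappa = assms(1)[unfolded P regular_normal_iff[OF N]]
  note kappa' = assms(2)[unfolded P' regular_normal_iff[OF N']]
  have params: "\<sigma>1 * \<sigma>2 * r\<^sup>2 = \<sigma>1 * \<sigma>2 * r'\<^sup>2" "\<sigma>2 * \<sigma>3 * q\<^sup>2 = \<sigma>2 * \<sigma>3 * q'\<^sup>2"
    "\<sigma>1 * \<sigma>2 * \<sigma>3 * r * q * Re z = \<sigma>1 * \<sigma>2 * \<sigma>3 * r' * q' * Re z'"
    using assms(3) unfolding P P' parameters_normal_triple[OF N(1) signs]
      parameters_normal_triple[OF N'(1) signs] by blast+
  have nz: "\<sigma>1 \<noteq> 0" "\<sigma>2 \<noteq> 0" "\<sigma>3 \<noteq> 0"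
    using signs by auto
  have "r = r'" "q = q'"
    using params(1,2) nz N(2,3) N'(2,3) by (simp_all add: power2_eq_iff_nonneg)
  then have Re_z: "Re z = Re z'"
    using params(3) nz N(2,3) by simp
  have Re_cancel: "x = y"
    if "k = e - (a + b + x) / 2" "k = e' - (a' + b' + y) / 2" "e = e'" "a = a'" "b = b'"
    for k e e' a a' b b' x y :: real
    using that by simp
  have Im_cancel: "x = y" if "k = x + a + b + c" "k = y + a + b + c" for k a b c x y :: real
    using that by simp
  have "Re (of_real (\<sigma>1 * \<sigma>2 * \<sigma>3 * r * q) * z) = Re (of_real (\<sigma>1 * \<sigma>2 * \<sigma>3 * r' * q') * z')"
    using Re_z \<open>r = r'\<close> \<open>q = q'\<close> by simp
  then have s: "\<sigma>1 * \<sigma>3 * (cmod z)\<^sup>2 = \<sigma>1 * \<sigma>3 * (cmod z')\<^sup>2"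
    by (rule Re_cancel[OF kappa[THEN conjunct1] kappa'[THEN conjunct1] _ params(1,2)])
  \<comment> \<open>\<open>Re z\<close> and \<open>cmod z\<close> leave the sign of
    \<open>Im z\<close> open; the imaginary part of the trace equation settles it.\<close>
  have "Im (of_real (\<sigma>1 * \<sigma>2 * \<sigma>3 * r * q) * z) = Im (of_real (\<sigma>1 * \<sigma>2 * \<sigma>3 * r' * q') * z')"
    using kappa[THEN conjunct2] kappa'[THEN conjunct2] unfolding s params(1,2) by (rule Im_cancel)
  then have "Im z = Im z'"
    using nz N(2,3) \<open>r = r'\<close> \<open>q = q'\<close> by simp
  with Re_z have "z = z'"
    by (simp add: complex_eq_iff)
  then obtain f c where f: "f \<in> SU21 h" "c \<noteq> 0" "f u = c *s u'" "f v = c *s v'" "f w = c *s w'"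
    using same_gram_imp_isometric[OF N(4), of u' v' w'] N(1) N'(1) \<open>r = r'\<close> \<open>q = q'\<close>
    unfolding normal_triple_def by metis
  then have "P' = (f ` vec.span {u}, f ` vec.span {v}, f ` vec.span {w})"
    by (simp add: P' SU21_image_span span_scale_singleton)
  then show ?thesis
    using SU21_orbit_image[OF f(1)] P by simp
qed

text \<open>The parameters depend only on values of \<open>h\<close> on a normalized triple, and
  these are preserved by isometries.\<close>

lemma parameters_eq_of_orbit_eq:
  assumes "regular P" "SU21_orbit h P = SU21_orbit h P'"
  shows "parameters h P = parameters h P'"
proof -
  obtain u v w r q z where N: "normal r q z u v w"
    and P: "P = (vec.span {u}, vec.span {v}, vec.span {w})"
    using regular_imp_normal[OF assms(1)] by blast
  have "P' \<in> SU21_orbit h P'"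
    by (cases P') (auto simp: SU21_orbit_def intro!: exI[of _ id] id_in_SU21)
  then have "P' \<in> SU21_orbit h P"
    by (simp only: assms(2))
  then obtain f where f: "f \<in> SU21 h" "P' = (f ` vec.span {u}, f ` vec.span {v}, f ` vec.span {w})"
    unfolding P SU21_orbit_def by blast
  have "h (f x) (f y) = h x y" for x y
    using f(1) by (simp add: SU21_def)
  then have "normal r q z (f u) (f v) (f w)"
    using N by (simp add: normal_triple_def)
  then show ?thesis
    unfolding f(2) P SU21_image_span[OF f(1)]
    using parameters_normal_triple[OF _ signs] N by metis
qed

lemma surface_point_realized:
  assumes "T \<in> surface (\<alpha>1, \<alpha>2, \<alpha>3) (\<sigma>1, \<sigma>2, \<sigma>3) \<tau>"
  obtains P where "regular P" "parameters h P = T"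
proof -
  obtain t1 t2 t where T: "T = (t1, t2, t)"
    by (cases T)
  obtain s y where eq: "t\<^sup>2 + y\<^sup>2 = t1 * t2 * s"
    and kappa: "Re (kappa (\<alpha>1, \<alpha>2, \<alpha>3) \<tau>) = t - (t1 + t2 + s) / 2"
      "Im (kappa (\<alpha>1, \<alpha>2, \<alpha>3) \<tau>) = y + chi \<alpha>3 * t1 + chi \<alpha>2 * s + chi \<alpha>1 * t2"
    and ineq: "\<sigma>1 * \<sigma>2 * t1 > 0" "\<sigma>1 * \<sigma>2 * t1 > \<sigma>1 * \<sigma>2" "\<sigma>2 * \<sigma>3 * t2 > 0"
      "\<sigma>1 * \<sigma>2 * \<sigma>3 * (2 * Re (kappa (\<alpha>1, \<alpha>2, \<alpha>3) \<tau>) + 1) < 0"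
    using assms unfolding T surface_iff by blast
  define r q where "r = sqrt (\<sigma>1 * \<sigma>2 * t1)" and "q = sqrt (\<sigma>2 * \<sigma>3 * t2)"
  have pos: "r > 0" "q > 0" and squares: "r\<^sup>2 = \<sigma>1 * \<sigma>2 * t1" "q\<^sup>2 = \<sigma>2 * \<sigma>3 * t2"
    using ineq by (simp_all add: r_def q_def)
  \<comment> \<open>Chosen so that \<open>eta\<close> of the triple becomes
    \<open>Complex t y\<close>.\<close>
  define z where "z = of_real (\<sigma>1 * \<sigma>2 * \<sigma>3 / (r * q)) * Complex t y"
  have eta: "of_real (\<sigma>1 * \<sigma>2 * \<sigma>3 * r * q) * z = Complex t y"
    using pos signs by (auto simp: z_def complex_eq_iff)
  have t1: "\<sigma>1 * \<sigma>2 * r\<^sup>2 = t1" and t2: "\<sigma>2 * \<sigma>3 * q\<^sup>2 = t2"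
    using signs by (auto simp: squares)
  have "t1 \<noteq> 0" "t2 \<noteq> 0"
    using ineq by auto
  \<comment> \<open>The equation of the surface enters here: compared with the same identity for
    \<open>z\<close>, it shows that \<open>s\<close> is the tance of the first and third points of
    the triple to be built.\<close>
  have "t\<^sup>2 + y\<^sup>2 = t1 * t2 * (\<sigma>1 * \<sigma>3 * (cmod z)\<^sup>2)"
    using norm_eta[of r q z] unfolding eta t1 t2 cmod_power2[of "Complex t y"] by simp
  then have s: "\<sigma>1 * \<sigma>3 * (cmod z)\<^sup>2 = s"
    using \<open>t1 \<noteq> 0\<close> \<open>t2 \<noteq> 0\<close> by (simp add: eq)
  have "Re (of_real (\<sigma>1 * \<sigma>2 * \<sigma>3 * r * q) * z) = t"
    by (simp only: eta complex.sel)
  then have Re_z: "\<sigma>1 * \<sigma>2 * \<sigma>3 * r * q * Re z = t"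
    by simp
  have "\<sigma>1 * \<sigma>2 * \<sigma>3 * (2 * Re (kappa (\<alpha>1, \<alpha>2, \<alpha>3) \<tau>) + 1) =
      \<sigma>1 * \<sigma>2 * \<sigma>3 + 2 * r * q * Re z - \<sigma>1 * q\<^sup>2 - \<sigma>2 * (cmod z)\<^sup>2 - \<sigma>3 * r\<^sup>2"
    unfolding kappa(1) t1[symmetric] t2[symmetric] s[symmetric] Re_z[symmetric]
    using signs by (auto simp: field_simps)
  then obtain u v w where N: "normal r q z u v w"
    using exists_normal_triple[of \<sigma>1 \<sigma>2 r \<sigma>3 q z] signs(1) ineq(2,4) squares(1) by auto
  have "Re (gram h u v w) < 0"
    using gram_normal_kappa[OF N, unfolded eta t1 t2 s] kappa(1) ineq(4) by simp
  then have det: "det (cols u v w) \<noteq> 0"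
    by (simp add: Re_gram_neg_iff)
  show thesis
  proof
    show "regular (vec.span {u}, vec.span {v}, vec.span {w})"
      unfolding regular_normal_iff[OF N pos det] eta t1 t2 s using kappa by simp
    show "parameters h (vec.span {u}, vec.span {v}, vec.span {w}) = T"
      unfolding parameters_normal_triple[OF N signs] T t1 t2 Re_z ..
  qed
qed

end

theorem theorem5p2:
  fixes h :: form
    and \<alpha>1 \<alpha>2 \<alpha>3 :: complex and \<sigma>1 \<sigma>2 \<sigma>3 :: real and \<tau> :: complex
  assumes "hermitian_form h" and "signature_ppm h"
    and "{\<alpha>1, \<alpha>2, \<alpha>3} \<subseteq> sphere 0 1 - {\<omega>. \<omega> ^ 3 = 1}"
    and "{\<sigma>1, \<sigma>2, \<sigma>3} \<subseteq> {-1, 1}"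
    and "\<not> (\<sigma>1 > 0 \<and> \<sigma>2 > 0)" and "\<not> (\<sigma>1 > 0 \<and> \<sigma>3 > 0)" and "\<not> (\<sigma>2 > 0 \<and> \<sigma>3 > 0)"
  defines "T \<equiv> {P. strongly_regular h (\<alpha>1, \<alpha>2, \<alpha>3) (\<sigma>1, \<sigma>2, \<sigma>3) \<tau> P}"
  shows "\<exists>F. (\<forall>P\<in>T. F (SU21_orbit h P) = parameters h P) \<and>
             bij_betw F (SU21_orbit h ` T) (surface (\<alpha>1, \<alpha>2, \<alpha>3) (\<sigma>1, \<sigma>2, \<sigma>3) \<tau>)"
proof -
  have \<alpha>: "cmod \<alpha>1 = 1" "cmod \<alpha>2 = 1" "cmod \<alpha>3 = 1" "\<alpha>1 ^ 3 \<noteq> 1" "\<alpha>2 ^ 3 \<noteq> 1" "\<alpha>3 ^ 3 \<noteq> 1"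
    using assms(3) by simp_all
  have \<sigma>: "\<sigma>1 \<in> {-1, 1}" "\<sigma>2 \<in> {-1, 1}" "\<sigma>3 \<in> {-1, 1}"
    using assms(4) by simp_all
  interpret admissible_parameters h \<alpha>1 \<alpha>2 \<alpha>3 \<sigma>1 \<sigma>2 \<sigma>3 \<tau>
    by unfold_locales (fact assms(1,2,5,7) \<alpha> \<sigma>)+
  \<comment> \<open>A value on an orbit is taken at a chosen member of \<open>T\<close>; invariance
    of \<open>parameters\<close> makes the choice irrelevant.\<close>
  define F where "F = (\<lambda>X. parameters h (SOME P. P \<in> T \<and> SU21_orbit h P = X))"
  have F: "F (SU21_orbit h P) = parameters h P" if "P \<in> T" for P
  proof -
    let ?Q = "SOME Q. Q \<in> T \<and> SU21_orbit h Q = SU21_orbit h P"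
    have "?Q \<in> T \<and> SU21_orbit h ?Q = SU21_orbit h P"
      by (rule someI[of _ P]) (simp add: that)
    then show ?thesis
      unfolding F_def using parameters_eq_of_orbit_eq by (simp add: T_def)
  qed
  have "inj_on F (SU21_orbit h ` T)"
  proof (intro inj_onI; elim imageE)
    fix X Y P Q
    assume "F X = F Y" and X: "X = SU21_orbit h P" "P \<in> T" and Y: "Y = SU21_orbit h Q" "Q \<in> T"
    then have "parameters h P = parameters h Q"
      using F by metis
    then show "X = Y"
      using X Y orbit_eq_of_parameters_eq[of P Q] by (simp add: T_def)
  qed
  moreover have "F ` SU21_orbit h ` T = parameters h ` T"
    using F by (simp add: image_image)
  moreover have "parameters h ` T = surface (\<alpha>1, \<alpha>2, \<alpha>3) (\<sigma>1, \<sigma>2, \<sigma>3) \<tau>"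
  proof
    show "parameters h ` T \<subseteq> surface (\<alpha>1, \<alpha>2, \<alpha>3) (\<sigma>1, \<sigma>2, \<sigma>3) \<tau>"
      unfolding T_def using parameters_in_surface by blast
    show "surface (\<alpha>1, \<alpha>2, \<alpha>3) (\<sigma>1, \<sigma>2, \<sigma>3) \<tau> \<subseteq> parameters h ` T"
      unfolding T_def using surface_point_realized by blast
  qed
  ultimately have "bij_betw F (SU21_orbit h ` T) (surface (\<alpha>1, \<alpha>2, \<alpha>3) (\<sigma>1, \<sigma>2, \<sigma>3) \<tau>)"
    by (simp add: bij_betw_def)
  then show ?thesis
    using F by blast
qed

end
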